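(* Let $\varepsilon\in\{1,-1\}$. A complete set of representatives of the equivalence classes of irreducible projective representations (spin IRs) of $G$ of spin type $\chi_{\varepsilon,0}$, that is, of irreducible complex linear representations $\Pi$ of $R(G)$ with $\Pi(z_{12})=\omega^{\varepsilon}I$ and $\Pi(z_{23})=I$, is given by $\Pi_{\varepsilon,0;r}$, $r=0,1,2$ (mod $3$), regarded as representations of $R(G)$ through $\delta:R(G)\to\widetilde G$.
   Context: Representations are finite-dimensional over $\mathbb{C}$, "IR" means irreducible representation, $\omega=\exp(2\pi i/3)$, and $[x,y]=xyx^{-1}y^{-1}$. $G$ is the group of order 27 generated by $x_1,x_2,x_3$ with relations $x_1^3=x_2^3=x_3^3=1$, $x_2$ central, $[x_1,x_3]=x_2$. Its Schur multiplier is $M(G)\cong \mathbb{Z}_3\times\mathbb{Z}_3$. $R(G)$ is the representation group of $G$ of order 243 with generators $\eta_1,\eta_2,\eta_3,z_{12},z_{23}$ and relations: $z_{12},z_{23}$ central with $z_{12}^3=z_{23}^3=1$; $\eta_j^3=1$ ($j=1,2,3$); $\eta_2\eta_1\eta_2^{-1}=z_{12}^{-1}\eta_1$; $\eta_3\eta_1\eta_3^{-1}=z_{12}\eta_1\eta_2^2$; $\eta_3\eta_2\eta_3^{-1}=z_{23}^{-1}\eta_2$. Every element is uniquely $z_{12}^{\beta_1}z_{23}^{\beta_2}\eta_1^{\gamma_1}\eta_2^{\gamma_2}\eta_3^{\gamma_3}$ with exponents mod 3. The subgroup $M(G)=\langle z_{12}\rangle\times\langle z_{23}\rangle$ is central and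 $R(G)/M(G)\cong G$ via $\eta_j\mapsto x_j$. Irreducible projective representations of $G$ are given by IRs $\Pi$ of $R(G)$; the spin type of $\Pi$ is the character $\chi$ of $M(G)$ with $\Pi(z)=\chi(z)I$ ($z\in M(G)$). Write $\chi_{\varepsilon,\mu}$ for the character with $\chi_{\varepsilon,\mu}(z_{12})=\omega^\varepsilon$, $\chi_{\varepsilon,\mu}(z_{23})=\omega^\mu$. $\widetilde G$ is the group of order 81 with generators $\xi_1,\xi_2,\xi_3,z_{12}$ and relations $\xi_1^3=\xi_2^3=\xi_3^3=1$, $z_{12}=[\xi_1,\xi_2]$ central, $z_{12}^3=1$, $\xi_2=[\xi_1,\xi_3]$, $[\xi_2,\xi_3]=1$. The homomorphism $\delta:R(G)\to\widetilde G$ is $\eta_j\mapsto\xi_j$, $z_{12}\mapsto z_{12}$, $z_{23}\mapsto 1$. One has $\widetilde G=U\rtimes W$ with $U=\langle z_{12},\xi_1,\xi_2\rangle$ (order 27) and $W=\langle w\rangle$, $w=\xi_3$. Let $\rho=P_{\varepsilon,0}$ be the IR of $U$ on $\mathbb{C}^3$ given by $\rho(z_{12})=\omega^{\varepsilon}I$, $\rho(\xi_1)=\mathrm{diag}(1,\omega^{-\varepsilon},\omega^{\varepsilon})$, $\rho(\xi_2)=J$, where $$J=\begin{bmatrix}0&1&0\\0&0&1\\1&0&0\end{bmatrix}.$$ Let $J_\rho(w)$ be a fixed invertible $3\times3$ matrix with $\rho(wuw^{-1})J_\rho(w)=J_\rho(w)\rho(u)$ for all $u\in U$, normalized by $J_\rho(w)^3=I$.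 For $r\in\{0,1,2\}$, $\Pi_{\varepsilon,0;r}$ is the representation of $\widetilde G$ on $\mathbb{C}^3$ defined by $\Pi_{\varepsilon,0;r}(u\,w^k)=\omega^{rk}\rho(u)J_\rho(w)^k$ ($u\in U$, $0\le k\le 2$). *)

theory Defs
  imports
    "HOL-Algebra.Algebra"
    "Jordan_Normal_Form.VS_Connect"
begin

section \<open>Groups given by generators and relations\<close>

datatype 'g letter = Gen 'g | Inv 'g

type_synonym 'g word = "'g letter list"

text \<open>A pair \<open>(u, v)\<close> of words in the set \<open>rels\<close> stands for the relation \<open>u = v\<close>.\<close>

inductive word_eq :: "('g word \<times> 'g word) set \<Rightarrow> 'g word \<Rightarrow> 'g word \<Rightarrow> bool"
  for rels :: "('g word \<times> 'g word) set" where
  refl: "word_eq rels u u"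
| sym: "word_eq rels u v \<Longrightarrow> word_eq rels v u"
| trans: "word_eq rels u v \<Longrightarrow> word_eq rels v w \<Longrightarrow> word_eq rels u w"
| append: "word_eq rels u v \<Longrightarrow> word_eq rels u' v' \<Longrightarrow> word_eq rels (u @ u') (v @ v')"
| Gen_Inv: "word_eq rels [Gen g, Inv g] []"
| Inv_Gen: "word_eq rels [Inv g, Gen g] []"
| rel: "(u, v) \<in> rels \<Longrightarrow> word_eq rels u v"

definition word_class :: "('g word \<times> 'g word) set \<Rightarrow> 'g word \<Rightarrow> 'g word set" where
  "word_class rels u = {v. word_eq rels u v}"

definition presented_group :: "('g word \<times> 'g word) set \<Rightarrow> 'g word set monoid" where
  "presented_group rels =
     \<lparr> carrier = range (word_class rels),
       monoid.mult = (\<lambda>A B. \<Union>a\<in>A. \<Union>b\<in>B. word_class rels (a @ b)),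
       one = word_class rels [] \<rparr>"

fun letter_val :: "('a, 'b) monoid_scheme \<Rightarrow> ('g \<Rightarrow> 'a) \<Rightarrow> 'g letter \<Rightarrow> 'a" where
  "letter_val H f (Gen g) = f g"
| "letter_val H f (Inv g) = inv\<^bsub>H\<^esub> (f g)"

definition word_val :: "('a, 'b) monoid_scheme \<Rightarrow> ('g \<Rightarrow> 'a) \<Rightarrow> 'g word \<Rightarrow> 'a" where
  "word_val H f w = foldr (\<lambda>l a. letter_val H f l \<otimes>\<^bsub>H\<^esub> a) w \<one>\<^bsub>H\<^esub>"

text \<open>The map out of a presented group with prescribed images \<open>f\<close> of the generators. It does not
  depend on the chosen word, and is the unique such homomorphism, as soon as the \<open>f g\<close> lie in the
  group \<open>H\<close> and satisfy the defining relations there.\<close>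

definition induced_hom :: "('a, 'b) monoid_scheme \<Rightarrow> ('g \<Rightarrow> 'a) \<Rightarrow> 'g word set \<Rightarrow> 'a" where
  "induced_hom H f A = word_val H f (SOME w. w \<in> A)"

abbreviation comm_word :: "'g \<Rightarrow> 'g \<Rightarrow> 'g word" where
  "comm_word x y \<equiv> [Gen x, Gen y, Inv x, Inv y]"

definition central_rels :: "'g \<Rightarrow> ('g word \<times> 'g word) set" where
  "central_rels z = {([Gen z, Gen g], [Gen g, Gen z]) | g. True}"

definition cube_rel :: "'g \<Rightarrow> 'g word \<times> 'g word" where
  "cube_rel x = ([Gen x, Gen x, Gen x], [])"


section \<open>The groups $R(G)$ and $\widetilde G$\<close>

datatype R_gen = Eta1 | Eta2 | Eta3 | RZ12 | RZ23

definition R_rels :: "(R_gen word \<times> R_gen word) set" where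
  "R_rels =
     central_rels RZ12 \<union> central_rels RZ23 \<union>
     {cube_rel RZ12, cube_rel RZ23, cube_rel Eta1, cube_rel Eta2, cube_rel Eta3,
      ([Gen Eta2, Gen Eta1, Inv Eta2], [Inv RZ12, Gen Eta1]),
      ([Gen Eta3, Gen Eta1, Inv Eta3], [Gen RZ12, Gen Eta1, Gen Eta2, Gen Eta2]),
      ([Gen Eta3, Gen Eta2, Inv Eta3], [Inv RZ23, Gen Eta2])}"

definition RG :: "R_gen word set monoid" where
  "RG = presented_group R_rels"

definition R_el :: "R_gen \<Rightarrow> R_gen word set" where
  "R_el g = word_class R_rels [Gen g]"

datatype T_gen = Xi1 | Xi2 | Xi3 | TZ12

definition T_rels :: "(T_gen word \<times> T_gen word) set" where
  "T_rels =
     central_rels TZ12 \<union>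
     {cube_rel Xi1, cube_rel Xi2, cube_rel Xi3, cube_rel TZ12,
      ([Gen TZ12], comm_word Xi1 Xi2),
      ([Gen Xi2], comm_word Xi1 Xi3),
      (comm_word Xi2 Xi3, [])}"

definition GT :: "T_gen word set monoid" where
  "GT = presented_group T_rels"

definition T_el :: "T_gen \<Rightarrow> T_gen word set" where
  "T_el g = word_class T_rels [Gen g]"

definition delta :: "R_gen word set \<Rightarrow> T_gen word set" where
  "delta = induced_hom GT (\<lambda>g. case g of
       Eta1 \<Rightarrow> T_el Xi1 | Eta2 \<Rightarrow> T_el Xi2 | Eta3 \<Rightarrow> T_el Xi3
     | RZ12 \<Rightarrow> T_el TZ12 | RZ23 \<Rightarrow> \<one>\<^bsub>GT\<^esub>)"

definition U :: "T_gen word set set" where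
  "U = generate GT {T_el TZ12, T_el Xi1, T_el Xi2}"


section \<open>Complex matrix representations\<close>

definition GL :: "nat \<Rightarrow> complex mat monoid" where
  "GL n = units_of (ring_mat TYPE(complex) n ())"

definition is_rep :: "('a, 'b) monoid_scheme \<Rightarrow> nat \<Rightarrow> ('a \<Rightarrow> complex mat) \<Rightarrow> bool" where
  "is_rep H n \<pi> \<longleftrightarrow> \<pi> \<in> hom H (GL n)"

definition is_irrep :: "('a, 'b) monoid_scheme \<Rightarrow> nat \<Rightarrow> ('a \<Rightarrow> complex mat) \<Rightarrow> bool" where
  "is_irrep H n \<pi> \<longleftrightarrow> is_rep H n \<pi> \<and> n > 0 \<and>
     (\<forall>W. VectorSpace.subspace class_ring W (module_vec TYPE(complex) n) \<and>
          (\<forall>g\<in>carrier H. \<forall>v\<in>W. \<pi> g *\<^sub>v v \<in> W) \<longrightarrow>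
          W = {0\<^sub>v n} \<or> W = carrier_vec n)"

definition rep_equiv ::
  "('a, 'b) monoid_scheme \<Rightarrow> nat \<Rightarrow> ('a \<Rightarrow> complex mat) \<Rightarrow> nat \<Rightarrow> ('a \<Rightarrow> complex mat) \<Rightarrow> bool" where
  "rep_equiv H n \<pi> m \<sigma> \<longleftrightarrow> n = m \<and>
     (\<exists>T\<in>carrier (GL n). \<forall>g\<in>carrier H. T * \<pi> g = \<sigma> g * T)"

definition omega :: complex where
  "omega = exp (2 * of_real pi * \<i> / 3)"

text \<open>Irreducible representations of $R(G)$ of spin type $\chi_{\varepsilon,\mu}$. Since
  $M(G) = \langle z_{12}\rangle \times \langle z_{23}\rangle$, the type is determined on
  $z_{12}$ and $z_{23}$.\<close>

definition is_spin_irrep :: "int \<Rightarrow> int \<Rightarrow> nat \<Rightarrow> (R_gen word set \<Rightarrow> complex mat) \<Rightarrow> bool" where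
  "is_spin_irrep \<epsilon> \<mu> n \<pi> \<longleftrightarrow> is_irrep RG n \<pi> \<and>
     \<pi> (R_el RZ12) = (omega powi \<epsilon>) \<cdot>\<^sub>m 1\<^sub>m n \<and>
     \<pi> (R_el RZ23) = (omega powi \<mu>) \<cdot>\<^sub>m 1\<^sub>m n"


section \<open>The representations $P_{\varepsilon,0}$ and $\Pi_{\varepsilon,0;r}$\<close>

text \<open>The homomorphism property and the values on the generators of \<open>U\<close> determine
  $P_{\varepsilon,0}$ uniquely on \<open>U\<close>.\<close>

definition is_P :: "int \<Rightarrow> (T_gen word set \<Rightarrow> complex mat) \<Rightarrow> bool" where
  "is_P \<epsilon> \<rho> \<longleftrightarrow> is_rep (GT\<lparr>carrier := U\<rparr>) 3 \<rho> \<and>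
     \<rho> (T_el TZ12) = (omega powi \<epsilon>) \<cdot>\<^sub>m 1\<^sub>m 3 \<and>
     \<rho> (T_el Xi1) = mat_of_rows_list 3
       [[1, 0, 0],
        [0, omega powi (- \<epsilon>), 0],
        [0, 0, omega powi \<epsilon>]] \<and>
     \<rho> (T_el Xi2) = mat_of_rows_list 3
       [[0, 1, 0],
        [0, 0, 1],
        [1, 0, 0]]"

definition is_J :: "(T_gen word set \<Rightarrow> complex mat) \<Rightarrow> complex mat \<Rightarrow> bool" where
  "is_J \<rho> J \<longleftrightarrow> J \<in> carrier_mat 3 3 \<and> invertible_mat J \<and>
     (\<forall>u\<in>U. \<rho> (T_el Xi3 \<otimes>\<^bsub>GT\<^esub> u \<otimes>\<^bsub>GT\<^esub> inv\<^bsub>GT\<^esub> (T_el Xi3)) * J = J * \<rho> u) \<and>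
     J ^\<^sub>m 3 = 1\<^sub>m 3"

text \<open>$\Pi_{\varepsilon,0;r}(u w^k) = \omega^{rk} \rho(u) J_\rho(w)^k$; the description is unique on
  $\widetilde G = U \rtimes \langle w\rangle$, and irrelevant elsewhere.\<close>

definition Pi_rep ::
  "(T_gen word set \<Rightarrow> complex mat) \<Rightarrow> complex mat \<Rightarrow> nat \<Rightarrow> T_gen word set \<Rightarrow> complex mat" where
  "Pi_rep \<rho> J r g = (THE M. \<exists>u\<in>U. \<exists>k\<le>(2::nat).
     g = u \<otimes>\<^bsub>GT\<^esub> (T_el Xi3 [^]\<^bsub>GT\<^esub> k) \<and>
     M = (omega ^ (r * k)) \<cdot>\<^sub>m (\<rho> u * J ^\<^sub>m k))"

end

theory Submission
  imports Defs
begin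

text \<open>
  Let \<open>q = \<omega>\<^sup>\<epsilon>\<close>, a primitive cube root of unity. In an irreducible representation \<open>\<pi>\<close> of the given
  spin type the matrices \<open>A, B, C\<close> of \<open>\<eta>\<^sub>1, \<eta>\<^sub>2, \<eta>\<^sub>3\<close> have cube \<open>1\<close> and satisfy \<open>A B = q B A\<close>,
  \<open>A C = B C A\<close> and \<open>B C = C B\<close>. The first of these relations says that \<open>A\<close> and \<open>B\<close> represent
  the Heisenberg group modulo \<open>3\<close> with a nontrivial central character, and such a
  representation contains the one by clock and shift matrices: \<open>B\<close> permutes the eigenspaces of \<open>A\<close>
  cyclically, so \<open>A\<close> fixes a nonzero vector \<open>v\<close>, and \<open>v, B\<^sup>2 v, B v\<close> are the columns of a nonzero
  intertwiner \<open>S\<close> (\<open>heisenberg_fixed_vector\<close>, \<open>heisenberg_intertwiner\<close>).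

  The other two relations say that \<open>C\<close> and the matrix \<open>J\<close> act in the same way on the Heisenberg
  group, so \<open>S \<mapsto> C S J\<^sup>-\<^sup>1\<close> is an operator of order dividing \<open>3\<close> on intertwiners. Some
  eigencomponent of \<open>S\<close> under it is nonzero; if its eigenvalue is \<open>\<omega>\<^sup>r\<close>, it intertwines \<open>\<pi>\<close> with
  the representation in which \<open>\<eta>\<^sub>3\<close> acts by \<open>\<omega>\<^sup>r J\<close> (\<open>extended_intertwiner\<close>). By Schur's lemma
  (\<open>nonzero_intertwiner_imp_rep_equiv\<close>) the two are equivalent, which is completeness of the list.

  The listed representations are irreducible already under the clock and shift matrices
  (\<open>clock_shift_irreducible\<close>), and two of them are inequivalent because only scalars commute with
  both matrices (\<open>clock_shift_commutant\<close>) while the scalars \<open>\<omega>\<^sup>r\<close> differ. That they are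
  representations at all follows from the presentation of the group of order 81: clock, shift,
  \<open>\<omega>\<^sup>r J\<close> and the scalar \<open>q\<close> satisfy its relations, and the homomorphism so obtained agrees with the
  formula \<open>\<omega>\<^sup>r\<^sup>k \<rho>(u) J\<^sup>k\<close> for every way to write an element as \<open>u w\<^sup>k\<close> (\<open>Pi_rep_eq_sigma\<close>).
\<close>

section \<open>Groups given by generators and relations\<close>

lemma word_class_eq_iff:
  "word_class rels u = word_class rels v \<longleftrightarrow> word_eq rels u v"
proof
  assume "word_class rels u = word_class rels v"
  then have "v \<in> word_class rels u" by (simp add: word_class_def word_eq.refl)
  then show "word_eq rels u v" by (simp add: word_class_def)
next
  assume "word_eq rels u v"
  then show "word_class rels u = word_class rels v"
    unfolding word_class_def
    using word_eq.trans[of rels u v] word_eq.trans[OF word_eq.sym, of rels u v] by blast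
qed

lemma presented_mult:
  "word_class rels u \<otimes>\<^bsub>presented_group rels\<^esub> word_class rels v = word_class rels (u @ v)"
proof -
  have eq: "word_class rels (a @ b) = word_class rels (u @ v)"
    if "a \<in> word_class rels u" "b \<in> word_class rels v" for a b
    using word_eq.append[of rels u a v b] that
    by (subst eq_commute) (simp add: word_class_eq_iff, simp add: word_class_def)
  have ne: "u \<in> word_class rels u" "v \<in> word_class rels v"
    by (auto simp: word_class_def word_eq.refl)
  have "(\<Union>a\<in>word_class rels u. \<Union>b\<in>word_class rels v. word_class rels (a @ b))
      = word_class rels (u @ v)"
    using eq ne by blast
  then show ?thesis by (simp add: presented_group_def)
qed

lemma presented_one: "\<one>\<^bsub>presented_group rels\<^esub> = word_class rels []"
  by (simp add: presented_group_def)

lemma presented_carrier: "carrier (presented_group rels) = range (word_class rels)"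
  by (simp add: presented_group_def)

lemma presented_letter_inverses:
  "word_class rels [Gen g] \<otimes>\<^bsub>presented_group rels\<^esub> word_class rels [Inv g] = \<one>\<^bsub>presented_group rels\<^esub>"
  "word_class rels [Inv g] \<otimes>\<^bsub>presented_group rels\<^esub> word_class rels [Gen g] = \<one>\<^bsub>presented_group rels\<^esub>"
  by (simp_all add: presented_mult presented_one word_class_eq_iff word_eq.Gen_Inv word_eq.Inv_Gen)

lemma presented_monoid: "monoid (presented_group rels)"
  by unfold_locales (auto simp: presented_carrier presented_mult presented_one)

lemma presented_group_is_group: "group (presented_group rels)"
proof -
  interpret monoid "presented_group rels" by (rule presented_monoid)
  have letter: "word_class rels [l] \<in> Units (presented_group rels)" for l
  proof (cases l)
    case (Gen g)
    then show ?thesis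
      using presented_letter_inverses[of rels g]
      unfolding Units_def presented_carrier by blast
  next
    case (Inv g)
    then show ?thesis
      using presented_letter_inverses[of rels g]
      unfolding Units_def presented_carrier by blast
  qed
  have "word_class rels w \<in> Units (presented_group rels)" for w
  proof (induction w)
    case Nil
    then show ?case using Units_one_closed by (simp add: presented_one)
  next
    case (Cons l w)
    then show ?case
      using Units_m_closed[OF letter[of l] Cons] by (simp add: presented_mult)
  qed
  then have "carrier (presented_group rels) \<subseteq> Units (presented_group rels)"
    by (auto simp: presented_carrier)
  then show ?thesis by unfold_locales
qed

lemma presented_inv_gen:
  "inv\<^bsub>presented_group rels\<^esub> (word_class rels [Gen g]) = word_class rels [Inv g]"
proof -
  interpret group "presented_group rels" by (rule presented_group_is_group)
  show ?thesis
    by (rule inv_equality) (auto simp: presented_letter_inverses presented_carrier)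
qed

context group
begin

lemma word_val_Nil [simp]: "word_val G f [] = \<one>"
  by (simp add: word_val_def)

lemma word_val_Cons [simp]: "word_val G f (l # w) = letter_val G f l \<otimes> word_val G f w"
  by (simp add: word_val_def)

lemma letter_val_closed [simp]:
  "(\<And>g. f g \<in> carrier G) \<Longrightarrow> letter_val G f l \<in> carrier G"
  by (cases l) auto

lemma word_val_closed [simp]:
  "(\<And>g. f g \<in> carrier G) \<Longrightarrow> word_val G f w \<in> carrier G"
  by (induction w) auto

lemma word_val_append:
  "(\<And>g. f g \<in> carrier G) \<Longrightarrow> word_val G f (u @ v) = word_val G f u \<otimes> word_val G f v"
  by (induction u) (auto simp: m_assoc)

text \<open>This is what makes \<open>induced_hom\<close> independent of the word that its definition picks: congruent
  words have equal values as soon as the two sides of each relation have.\<close>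

lemma word_val_respects_word_eq:
  assumes f: "\<And>g. f g \<in> carrier G"
    and rels: "\<And>u v. (u, v) \<in> rels \<Longrightarrow> word_val G f u = word_val G f v"
    and "word_eq rels u v"
  shows "word_val G f u = word_val G f v"
  using assms(3)
proof (induction rule: word_eq.induct)
  case (rel u v)
  then show ?case by (rule rels)
qed (simp_all add: word_val_append f)

lemma induced_hom_word_class:
  assumes f: "\<And>g. f g \<in> carrier G"
    and rels: "\<And>u v. (u, v) \<in> rels \<Longrightarrow> word_val G f u = word_val G f v"
  shows "induced_hom G f (word_class rels w) = word_val G f w"
proof -
  have "(SOME v. v \<in> word_class rels w) \<in> word_class rels w"
    by (rule someI[of _ w]) (simp add: word_class_def word_eq.refl)
  then show ?thesis
    unfolding induced_hom_def
    using word_val_respects_word_eq[OF f rels, of rels w] by (simp add: word_class_def)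
qed

lemma induced_hom_is_hom:
  assumes f: "\<And>g. f g \<in> carrier G"
    and rels: "\<And>u v. (u, v) \<in> rels \<Longrightarrow> word_val G f u = word_val G f v"
  shows "induced_hom G f \<in> hom (presented_group rels) G"
  by (rule homI)
    (auto simp: presented_carrier presented_mult induced_hom_word_class[OF f rels]
      word_val_append f)

lemma induced_hom_gen:
  assumes f: "\<And>g. f g \<in> carrier G"
    and rels: "\<And>u v. (u, v) \<in> rels \<Longrightarrow> word_val G f u = word_val G f v"
  shows "induced_hom G f (word_class rels [Gen g]) = f g"
  using f by (simp add: induced_hom_word_class[OF f rels])

end

lemma word_val_presented:
  "word_val (presented_group rels) (\<lambda>g. word_class rels [Gen g]) w = word_class rels w"
proof -
  interpret group "presented_group rels" by (rule presented_group_is_group)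
  have "letter_val (presented_group rels) (\<lambda>g. word_class rels [Gen g]) l = word_class rels [l]" for l
    by (cases l) (auto simp: presented_inv_gen)
  then show ?thesis
    by (induction w) (auto simp: presented_one presented_mult)
qed

lemma presented_rel:
  assumes "(u, v) \<in> rels"
  shows "word_val (presented_group rels) (\<lambda>g. word_class rels [Gen g]) u
       = word_val (presented_group rels) (\<lambda>g. word_class rels [Gen g]) v"
  using assms by (simp add: word_val_presented word_class_eq_iff word_eq.rel)

lemma presented_gen_closed: "word_class rels [Gen g] \<in> carrier (presented_group rels)"
  by (simp add: presented_carrier)

text \<open>Every element is a word, so a property of all elements can be checked by multiplying on the left
  by one generator or inverse generator at a time. This serves both for the normal form in the
  group of order 81 and for intertwiners, which need only be tested on generators.\<close>

lemma presented_induct [consumes 1, case_names one gen inv]: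
  assumes "x \<in> carrier (presented_group rels)"
    and one: "P \<one>\<^bsub>presented_group rels\<^esub>"
    and gen: "\<And>g x. x \<in> carrier (presented_group rels) \<Longrightarrow> P x \<Longrightarrow>
      P (word_class rels [Gen g] \<otimes>\<^bsub>presented_group rels\<^esub> x)"
    and inv: "\<And>g x. x \<in> carrier (presented_group rels) \<Longrightarrow> P x \<Longrightarrow>
      P (inv\<^bsub>presented_group rels\<^esub> (word_class rels [Gen g]) \<otimes>\<^bsub>presented_group rels\<^esub> x)"
  shows "P x"
proof -
  have "P (word_class rels w)" for w
  proof (induction w)
    case Nil
    then show ?case using one by (simp add: presented_one)
  next
    case (Cons l w)
    then show ?case
      using gen[of "word_class rels w"] inv[of "word_class rels w"]
      by (cases l) (auto simp: presented_mult presented_inv_gen presented_carrier)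
  qed
  then show ?thesis using assms(1) by (auto simp: presented_carrier)
qed

section \<open>Matrix representations and Schur's lemma\<close>

lemma subspace_vec_iff:
  "VectorSpace.subspace class_ring W (module_vec TYPE('a::field) n) \<longleftrightarrow>
     W \<subseteq> carrier_vec n \<and> 0\<^sub>v n \<in> W \<and> (\<forall>v\<in>W. \<forall>w\<in>W. v + w \<in> W) \<and> (\<forall>c. \<forall>v\<in>W. c \<cdot>\<^sub>v v \<in> W)"
  by (auto simp: VectorSpace.subspace_def submodule_def vec_vs vec_module module_vec_simps)

lemma GL_group: "group (GL n)"
proof -
  interpret ring "ring_mat TYPE(complex) n ()" by (rule ring_mat)
  show ?thesis unfolding GL_def by (rule units_group)
qed

lemma GL_simps [simp]: "A \<otimes>\<^bsub>GL n\<^esub> B = A * B" "\<one>\<^bsub>GL n\<^esub> = 1\<^sub>m n"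
  by (simp_all add: GL_def units_of_def ring_mat_simps)

lemma GL_carrier_iff:
  "A \<in> carrier (GL n) \<longleftrightarrow>
     A \<in> carrier_mat n n \<and> (\<exists>B\<in>carrier_mat n n. B * A = 1\<^sub>m n \<and> A * B = 1\<^sub>m n)"
  by (simp add: GL_def units_of_def ring_mat_simps Units_def)

lemma GL_carrier_mat: "A \<in> carrier (GL n) \<Longrightarrow> A \<in> carrier_mat n n"
  by (simp add: GL_carrier_iff)

lemma GL_pow: "A \<in> carrier (GL n) \<Longrightarrow> A [^]\<^bsub>GL n\<^esub> (k::nat) = A ^\<^sub>m k"
  by (induction k) (auto simp: GL_carrier_iff)

lemma rep_mult:
  assumes "is_rep H n \<pi>" "g \<in> carrier H" "h \<in> carrier H"
  shows "\<pi> (g \<otimes>\<^bsub>H\<^esub> h) = \<pi> g * \<pi> h"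
  using assms hom_mult[of \<pi> H "GL n" g h] by (simp add: is_rep_def)

lemma rep_carrier_mat:
  assumes "is_rep H n \<pi>" "g \<in> carrier H"
  shows "\<pi> g \<in> carrier_mat n n"
  using assms hom_in_carrier[of \<pi> H "GL n" g] by (simp add: is_rep_def GL_carrier_mat)

lemma rep_one:
  assumes "is_rep H n \<pi>" "group H"
  shows "\<pi> \<one>\<^bsub>H\<^esub> = 1\<^sub>m n"
  using hom_one[of \<pi> H "GL n"] assms GL_group by (simp add: is_rep_def)

lemma zero_matI:
  fixes S :: "'a::semiring_1 mat"
  assumes S: "S \<in> carrier_mat n m" and zero: "\<And>v. v \<in> carrier_vec m \<Longrightarrow> S *\<^sub>v v = 0\<^sub>v n"
  shows "S = 0\<^sub>m n m"
proof (rule eq_matI)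
  fix i j assume "i < dim_row (0\<^sub>m n m :: 'a mat)" "j < dim_col (0\<^sub>m n m :: 'a mat)"
  then have ij: "i < n" "j < m" by auto
  have "S $$ (i, j) = (S *\<^sub>v unit_vec m j) $ i"
    using S ij by simp
  also have "\<dots> = 0" using zero[of "unit_vec m j"] ij by simp
  finally show "S $$ (i, j) = 0\<^sub>m n m $$ (i, j)" using ij by simp
qed (use S in auto)

text \<open>The trace serves as a substitute for dimension theory: for mutually inverse rectangular matrices
  it forces the two sizes to agree.\<close>

lemma trace_mult_commute:
  fixes A :: "'a::comm_semiring_1 mat"
  assumes A: "A \<in> carrier_mat n m" and B: "B \<in> carrier_mat m n"
  shows "(\<Sum>i<n. (A * B) $$ (i, i)) = (\<Sum>j<m. (B * A) $$ (j, j))"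
proof -
  have "(\<Sum>i<n. (A * B) $$ (i, i)) = (\<Sum>i<n. \<Sum>j<m. A $$ (i, j) * B $$ (j, i))"
    using A B by (intro sum.cong) (auto simp: scalar_prod_def lessThan_atLeast0)
  also have "\<dots> = (\<Sum>j<m. \<Sum>i<n. A $$ (i, j) * B $$ (j, i))"
    by (rule sum.swap)
  also have "\<dots> = (\<Sum>j<m. (B * A) $$ (j, j))"
    using A B by (intro sum.cong) (auto simp: scalar_prod_def lessThan_atLeast0 mult.commute)
  finally show ?thesis .
qed

text \<open>Surjectivity provides a right inverse \<open>R\<close> column by column. Since \<open>S (R S - 1) = 0\<close>, injectivity
  turns it into a left inverse, and comparing the traces of \<open>S R\<close> and \<open>R S\<close> in characteristic \<open>0\<close>
  gives \<open>n = m\<close>.\<close>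

lemma bijective_mat_inverse:
  fixes S :: "'a::field_char_0 mat"
  assumes S: "S \<in> carrier_mat n m"
    and inj: "\<And>v. v \<in> carrier_vec m \<Longrightarrow> S *\<^sub>v v = 0\<^sub>v n \<Longrightarrow> v = 0\<^sub>v m"
    and surj: "\<And>w. w \<in> carrier_vec n \<Longrightarrow> \<exists>v\<in>carrier_vec m. S *\<^sub>v v = w"
  obtains R where "R \<in> carrier_mat m n" "S * R = 1\<^sub>m n" "R * S = 1\<^sub>m m" "n = m"
proof -
  have "\<forall>i. \<exists>v\<in>carrier_vec m. S *\<^sub>v v = unit_vec n i"
    using surj by (meson unit_vec_carrier)
  then obtain x where x: "\<And>i. x i \<in> carrier_vec m" "\<And>i. S *\<^sub>v x i = unit_vec n i"
    by metis
  define R where "R = mat_of_cols m (map x [0..<n])"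
  have R: "R \<in> carrier_mat m n" by (simp add: R_def mat_of_cols_carrier(1)[of m "map x [0..<n]", simplified])
  have SR: "S * R = 1\<^sub>m n"
  proof (rule mat_col_eqI)
    fix i assume "i < dim_col (1\<^sub>m n :: 'a mat)"
    then have i: "i < n" by simp
    have "col (S * R) i = S *\<^sub>v col R i" using S R i by (intro col_mult2) auto
    also have "\<dots> = unit_vec n i" using i x by (simp add: R_def)
    finally show "col (S * R) i = col (1\<^sub>m n) i" using i by simp
  qed (use S R in auto)
  \<comment> \<open>Each column of \<open>R S - 1\<close> is killed by the injective map \<open>S\<close>, because \<open>S R S = S\<close>.\<close>
  have "R * S - 1\<^sub>m m = 0\<^sub>m m m"
  proof (rule zero_matI)
    fix v :: "'a vec" assume v: "v \<in> carrier_vec m"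
    have "S *\<^sub>v ((R * S - 1\<^sub>m m) *\<^sub>v v) = (S * (R * S - 1\<^sub>m m)) *\<^sub>v v"
      using S R v by (intro assoc_mult_mat_vec[symmetric]) auto
    also have "S * (R * S - 1\<^sub>m m) = S * (R * S) - S * 1\<^sub>m m"
      using S R by (intro mult_minus_distrib_mat) auto
    also have "S * (R * S) = (S * R) * S"
      using S R by (intro assoc_mult_mat[symmetric]) auto
    also have "(S * R) * S - S * 1\<^sub>m m = 0\<^sub>m n m" using S SR by auto
    also have "0\<^sub>m n m *\<^sub>v v = 0\<^sub>v n" using v by auto
    finally show "(R * S - 1\<^sub>m m) *\<^sub>v v = 0\<^sub>v m"
      by (intro inj) (use S R v in \<open>auto intro!: mult_mat_vec_carrier[of _ m m]\<close>)
  qed (use S R in auto)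
  have RS: "R * S = 1\<^sub>m m"
  proof (rule eq_matI)
    fix i j assume "i < dim_row (1\<^sub>m m :: 'a mat)" "j < dim_col (1\<^sub>m m :: 'a mat)"
    then show "(R * S) $$ (i, j) = 1\<^sub>m m $$ (i, j)"
      using arg_cong[OF \<open>R * S - 1\<^sub>m m = 0\<^sub>m m m\<close>, of "\<lambda>M. M $$ (i, j)"] R S by auto
  qed (use S R in auto)
  have "(of_nat n :: 'a) = of_nat m"
    using trace_mult_commute[OF S R] by (simp add: SR RS)
  then have "n = m" by simp
  then show ?thesis using that R SR RS by blast
qed

lemma irrep_rep: "is_irrep H n \<pi> \<Longrightarrow> is_rep H n \<pi>"
  by (simp add: is_irrep_def)

lemma irrep_invariant_subspace:
  assumes "is_irrep H n \<pi>" "VectorSpace.subspace class_ring W (module_vec TYPE(complex) n)"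
    and "\<And>g v. g \<in> carrier H \<Longrightarrow> v \<in> W \<Longrightarrow> \<pi> g *\<^sub>v v \<in> W"
  shows "W = {0\<^sub>v n} \<or> W = carrier_vec n"
  using assms(1)[unfolded is_irrep_def, THEN conjunct2, THEN conjunct2, rule_format, of W] assms(2,3)
  by simp

text \<open>Schur's lemma: the kernel of \<open>S\<close> is invariant under \<open>\<sigma>\<close> and its image is invariant under \<open>\<pi>\<close>, so
  irreducibility makes \<open>S\<close> bijective. The equivalence from \<open>\<pi>\<close> to \<open>\<sigma>\<close> is the inverse of \<open>S\<close>, since \<open>S\<close>
  itself maps from the space of \<open>\<sigma>\<close> to that of \<open>\<pi>\<close>.\<close>

lemma nonzero_intertwiner_imp_rep_equiv:
  assumes \<pi>: "is_irrep H n \<pi>" and \<sigma>: "is_irrep H m \<sigma>"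
    and S: "S \<in> carrier_mat n m" and S_ne: "S \<noteq> 0\<^sub>m n m"
    and inter: "\<And>g. g \<in> carrier H \<Longrightarrow> \<pi> g * S = S * \<sigma> g"
  shows "rep_equiv H n \<pi> m \<sigma>"
proof -
  have car\<pi>: "\<pi> g \<in> carrier_mat n n" and car\<sigma>: "\<sigma> g \<in> carrier_mat m m" if "g \<in> carrier H" for g
    using that irrep_rep[OF \<pi>] irrep_rep[OF \<sigma>] by (simp_all add: rep_carrier_mat)
  have move: "\<pi> g *\<^sub>v (S *\<^sub>v v) = S *\<^sub>v (\<sigma> g *\<^sub>v v)"
    if "g \<in> carrier H" "v \<in> carrier_vec m" for g v
  proof -
    have "\<pi> g *\<^sub>v (S *\<^sub>v v) = (\<pi> g * S) *\<^sub>v v"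
      using car\<pi>[OF that(1)] S that(2) by (intro assoc_mult_mat_vec[symmetric]) auto
    also have "\<dots> = S *\<^sub>v (\<sigma> g *\<^sub>v v)"
      unfolding inter[OF that(1)]
      using car\<sigma>[OF that(1)] S that(2) by (intro assoc_mult_mat_vec) auto
    finally show ?thesis .
  qed
  define K where "K = {v \<in> carrier_vec m. S *\<^sub>v v = 0\<^sub>v n}"
  define L where "L = (\<lambda>v. S *\<^sub>v v) ` carrier_vec m"
  have "VectorSpace.subspace class_ring K (module_vec TYPE(complex) m)"
    using S unfolding subspace_vec_iff K_def
    by (auto simp: mult_add_distrib_mat_vec mult_mat_vec)
  moreover have "\<sigma> g *\<^sub>v v \<in> K" if "g \<in> carrier H" "v \<in> K" for g v
  proof -
    have "\<pi> g *\<^sub>v 0\<^sub>v n = 0\<^sub>v n" using car\<pi>[OF that(1)] by auto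
    then show ?thesis using that move[of g v] car\<sigma>[OF that(1)] by (auto simp: K_def)
  qed
  ultimately have K: "K = {0\<^sub>v m} \<or> K = carrier_vec m"
    by (rule irrep_invariant_subspace[OF \<sigma>])
  have "K \<noteq> carrier_vec m"
    using zero_matI[OF S] S_ne unfolding K_def by blast
  with K have K0: "K = {0\<^sub>v m}" by blast
  have "VectorSpace.subspace class_ring L (module_vec TYPE(complex) n)"
    unfolding subspace_vec_iff
  proof (intro conjI ballI allI)
    show "L \<subseteq> carrier_vec n" using S by (auto simp: L_def)
    show "0\<^sub>v n \<in> L"
      unfolding L_def using S by (intro image_eqI[of _ _ "0\<^sub>v m"]) auto
  next
    fix v w assume "v \<in> L" "w \<in> L"
    then obtain x y where "x \<in> carrier_vec m" "y \<in> carrier_vec m" "v = S *\<^sub>v x" "w = S *\<^sub>v y"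
      by (auto simp: L_def)
    then show "v + w \<in> L" unfolding L_def
      using S by (intro image_eqI[of _ _ "x + y"]) (auto simp: mult_add_distrib_mat_vec)
  next
    fix c v assume "v \<in> L"
    then obtain x where "x \<in> carrier_vec m" "v = S *\<^sub>v x" by (auto simp: L_def)
    then show "c \<cdot>\<^sub>v v \<in> L" unfolding L_def
      using S by (intro image_eqI[of _ _ "c \<cdot>\<^sub>v x"]) (auto simp: mult_mat_vec)
  qed
  moreover have "\<pi> g *\<^sub>v v \<in> L" if "g \<in> carrier H" "v \<in> L" for g v
    using that move[OF that(1)] car\<sigma>[OF that(1)] by (auto simp: L_def)
  ultimately have L: "L = {0\<^sub>v n} \<or> L = carrier_vec n"
    by (rule irrep_invariant_subspace[OF \<pi>])
  have "L \<noteq> {0\<^sub>v n}"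
    using zero_matI[OF S] S_ne unfolding L_def by blast
  with L have "L = carrier_vec n" by blast
  then have surj: "\<exists>v\<in>carrier_vec m. S *\<^sub>v v = w" if "w \<in> carrier_vec n" for w
    using that unfolding L_def by (metis imageE)
  have inj: "v = 0\<^sub>v m" if "v \<in> carrier_vec m" "S *\<^sub>v v = 0\<^sub>v n" for v
    using that K0 unfolding K_def by blast
  obtain R where R: "R \<in> carrier_mat m n" "S * R = 1\<^sub>m n" "R * S = 1\<^sub>m m" and nm: "n = m"
    using bijective_mat_inverse[OF S inj surj] by blast
  have "R \<in> carrier (GL n)"
    using R S nm by (auto simp: GL_carrier_iff)
  moreover have "R * \<pi> g = \<sigma> g * R" if g: "g \<in> carrier H" for g
  proof -
    have "R * \<pi> g = R * ((\<pi> g * S) * R)"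
      using R S car\<pi>[OF g] by (subst assoc_mult_mat[of _ n n _ m _ n]) auto
    also have "(\<pi> g * S) * R = S * (\<sigma> g * R)"
      unfolding inter[OF g] using R(1) S car\<sigma>[OF g] by (intro assoc_mult_mat) auto
    also have "R * \<dots> = (R * S) * (\<sigma> g * R)"
      using R(1) S car\<sigma>[OF g] by (intro assoc_mult_mat[symmetric]) auto
    also have "\<dots> = \<sigma> g * R" using R car\<sigma>[OF g] by auto
    finally show ?thesis .
  qed
  ultimately show ?thesis unfolding rep_equiv_def using nm by blast
qed

lemma intertwines_presented:
  assumes "is_rep (presented_group rels) n \<pi>" "is_rep (presented_group rels) m \<sigma>"
    and S: "S \<in> carrier_mat n m"
    and gens: "\<And>x. \<pi> (word_class rels [Gen x]) * S = S * \<sigma> (word_class rels [Gen x])"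
    and g: "g \<in> carrier (presented_group rels)"
  shows "\<pi> g * S = S * \<sigma> g"
proof -
  let ?P = "presented_group rels"
  interpret P: group ?P by (rule presented_group_is_group)
  note car = rep_carrier_mat[OF assms(1)] rep_carrier_mat[OF assms(2)]
  note m = rep_mult[OF assms(1)] rep_mult[OF assms(2)]
  have mult: "\<pi> (x \<otimes>\<^bsub>?P\<^esub> y) * S = S * \<sigma> (x \<otimes>\<^bsub>?P\<^esub> y)"
    if x: "x \<in> carrier ?P" "\<pi> x * S = S * \<sigma> x" and y: "y \<in> carrier ?P" "\<pi> y * S = S * \<sigma> y" for x y
  proof -
    have "\<pi> (x \<otimes>\<^bsub>?P\<^esub> y) * S = \<pi> x * (\<pi> y * S)"
      using x y S car[of x] car[of y] by (simp add: m)
    also have "\<dots> = (\<pi> x * S) * \<sigma> y"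
      using x(1) y S car[of x] car[of y] by simp
    also have "\<dots> = S * \<sigma> (x \<otimes>\<^bsub>?P\<^esub> y)"
      using x y(1) S car[of x] car[of y] by (simp add: m)
    finally show ?thesis .
  qed
  have inverse: "\<pi> (inv\<^bsub>?P\<^esub> x) * S = S * \<sigma> (inv\<^bsub>?P\<^esub> x)"
    if x: "x \<in> carrier ?P" "\<pi> x * S = S * \<sigma> x" for x
  proof -
    have xi: "inv\<^bsub>?P\<^esub> x \<in> carrier ?P" using x by simp
    have one: "\<pi> (inv\<^bsub>?P\<^esub> x) * \<pi> x = 1\<^sub>m n" "\<sigma> x * \<sigma> (inv\<^bsub>?P\<^esub> x) = 1\<^sub>m m"
      using x(1) m(1)[OF xi x(1)] m(2)[OF x(1) xi] rep_one[OF assms(1) P.is_group]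
        rep_one[OF assms(2) P.is_group] by simp_all
    have "\<pi> (inv\<^bsub>?P\<^esub> x) * S = \<pi> (inv\<^bsub>?P\<^esub> x) * (S * (\<sigma> x * \<sigma> (inv\<^bsub>?P\<^esub> x)))"
      using S one by simp
    also have "S * (\<sigma> x * \<sigma> (inv\<^bsub>?P\<^esub> x)) = (\<pi> x * S) * \<sigma> (inv\<^bsub>?P\<^esub> x)"
      using x S car[of x] car[of "inv\<^bsub>?P\<^esub> x"] xi by simp
    also have "\<dots> = \<pi> x * (S * \<sigma> (inv\<^bsub>?P\<^esub> x))"
      using x(1) S car[of x] car[of "inv\<^bsub>?P\<^esub> x"] xi by simp
    also have "\<pi> (inv\<^bsub>?P\<^esub> x) * \<dots> = (\<pi> (inv\<^bsub>?P\<^esub> x) * \<pi> x) * (S * \<sigma> (inv\<^bsub>?P\<^esub> x))"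
      using x(1) S car[of x] car[of "inv\<^bsub>?P\<^esub> x"] xi
      by (intro assoc_mult_mat[symmetric, where ?n\<^sub>1.0 = n and ?n\<^sub>2.0 = n and ?n\<^sub>3.0 = n and ?n\<^sub>4.0 = m]) auto
    also have "\<dots> = S * \<sigma> (inv\<^bsub>?P\<^esub> x)"
      using one S car[of "inv\<^bsub>?P\<^esub> x"] xi by simp
    finally show ?thesis .
  qed
  show ?thesis
    using g
  proof (induction rule: presented_induct)
    case one
    then show ?case
      using S rep_one[OF assms(1) P.is_group] rep_one[OF assms(2) P.is_group] by simp
  next
    case (gen y x)
    then show ?case by (intro mult gens presented_gen_closed)
  next
    case (inv y x)
    then show ?case by (intro mult inverse gens presented_gen_closed P.inv_closed)
  qed
qed

section \<open>The defining relations without inverses\<close>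

context group
begin

lemma commutator_eq_iff:
  assumes "a \<in> carrier G" "b \<in> carrier G" "c \<in> carrier G"
  shows "a \<otimes> (b \<otimes> (inv a \<otimes> inv b)) = c \<longleftrightarrow> a \<otimes> b = c \<otimes> b \<otimes> a"
proof -
  have "a \<otimes> (b \<otimes> (inv a \<otimes> inv b)) = (a \<otimes> b) \<otimes> inv (b \<otimes> a)"
    using assms by (simp add: inv_mult_group m_assoc)
  then show ?thesis
    using assms inv_solve_right[of c "a \<otimes> b" "b \<otimes> a"] by (auto simp: m_assoc)
qed

lemma conjugate_eq_iff:
  assumes "a \<in> carrier G" "b \<in> carrier G" "c \<in> carrier G"
  shows "a \<otimes> (b \<otimes> inv a) = c \<longleftrightarrow> a \<otimes> b = c \<otimes> a"
  using assms inv_solve_right[of c "a \<otimes> b" a] by (auto simp: m_assoc)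

text \<open>The relation that describes conjugation of the first generator by the third contains the central
  element. Multiplying it on the left by \<open>y\<close> and moving \<open>y\<close> past \<open>x\<close> removes that element, because
  \<open>y\<close> has order dividing \<open>3\<close>. The result has the same form in both groups of interest.\<close>

lemma conjugation_relation_iff:
  assumes [simp]: "x \<in> carrier G" "y \<in> carrier G" "w \<in> carrier G" "z \<in> carrier G"
    and central: "z \<otimes> y = y \<otimes> z"
    and cube: "y \<otimes> (y \<otimes> y) = \<one>" and comm: "z \<otimes> y \<otimes> x = x \<otimes> y"
  shows "w \<otimes> x = z \<otimes> (x \<otimes> (y \<otimes> y)) \<otimes> w \<longleftrightarrow> y \<otimes> w \<otimes> x = x \<otimes> w"
proof -
  have "y \<otimes> (z \<otimes> (x \<otimes> (y \<otimes> y)) \<otimes> w) = (y \<otimes> z) \<otimes> x \<otimes> y \<otimes> y \<otimes> w"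
    by (simp add: m_assoc)
  also have "\<dots> = x \<otimes> (y \<otimes> (y \<otimes> y)) \<otimes> w"
    by (simp add: central[symmetric] comm) (simp add: m_assoc)
  finally have "y \<otimes> (z \<otimes> (x \<otimes> (y \<otimes> y)) \<otimes> w) = x \<otimes> w"
    by (simp add: cube)
  then show ?thesis
    by (metis assms(1-4) l_cancel m_assoc m_closed)
qed

lemma central_rels_iff:
  assumes "\<And>g. f g \<in> carrier G"
  shows "(\<forall>(u, v)\<in>central_rels z. word_val G f u = word_val G f v) \<longleftrightarrow>
     (\<forall>g. f z \<otimes> f g = f g \<otimes> f z)"
proof -
  have "central_rels z = range (\<lambda>g. ([Gen z, Gen g], [Gen g, Gen z]))"
    by (auto simp: central_rels_def)
  then show ?thesis using assms by simp
qed

lemma cube_rel_iff: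
  assumes "\<And>g. f g \<in> carrier G"
  shows "(case cube_rel x of (u, v) \<Rightarrow> word_val G f u = word_val G f v) \<longleftrightarrow>
     f x \<otimes> (f x \<otimes> f x) = \<one>"
  using assms by (simp add: cube_rel_def)

text \<open>Equations between products of generators translate directly into matrix identities.\<close>

lemma T_relations_iff:
  assumes f [simp]: "\<And>g. f g \<in> carrier G"
  shows "(\<forall>(u, v)\<in>T_rels. word_val G f u = word_val G f v) \<longleftrightarrow>
     (\<forall>g. f TZ12 \<otimes> f g = f g \<otimes> f TZ12) \<and>
     (\<forall>g. f g \<otimes> (f g \<otimes> f g) = \<one>) \<and>
     f TZ12 \<otimes> f Xi2 \<otimes> f Xi1 = f Xi1 \<otimes> f Xi2 \<and>
     f Xi2 \<otimes> f Xi3 \<otimes> f Xi1 = f Xi1 \<otimes> f Xi3 \<and>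
     f Xi2 \<otimes> f Xi3 = f Xi3 \<otimes> f Xi2"
proof -
  have all: "(\<forall>g. P g) \<longleftrightarrow> P Xi1 \<and> P Xi2 \<and> P Xi3 \<and> P TZ12" for P
  proof (intro iffI allI)
    fix g assume "P Xi1 \<and> P Xi2 \<and> P Xi3 \<and> P TZ12"
    then show "P g" by (cases g) simp_all
  qed simp
  have comm: "word_val G f [Gen x] = word_val G f (comm_word y z) \<longleftrightarrow> f x \<otimes> f z \<otimes> f y = f y \<otimes> f z" for x y z
    using commutator_eq_iff[of "f y" "f z" "f x"] by auto
  have comm_one: "word_val G f (comm_word Xi2 Xi3) = word_val G f [] \<longleftrightarrow> f Xi2 \<otimes> f Xi3 = f Xi3 \<otimes> f Xi2"
    using commutator_eq_iff[of "f Xi2" "f Xi3" \<one>] by simp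
  show ?thesis
    unfolding T_rels_def ball_Un central_rels_iff[OF f]
      all[of "\<lambda>g. f g \<otimes> (f g \<otimes> f g) = \<one>"]
    by (simp only: ball_simps prod.case cube_rel_iff[OF f] comm comm_one simp_thms conj_ac)
qed

text \<open>Written this way, the relations become those of the group of order 81 when the second central
  generator is sent to the identity, so the existence of \<open>delta\<close> can be read off.\<close>

lemma R_relations_iff:
  assumes f [simp]: "\<And>g. f g \<in> carrier G"
  shows "(\<forall>(u, v)\<in>R_rels. word_val G f u = word_val G f v) \<longleftrightarrow>
     (\<forall>g. f RZ12 \<otimes> f g = f g \<otimes> f RZ12) \<and> (\<forall>g. f RZ23 \<otimes> f g = f g \<otimes> f RZ23) \<and>
     (\<forall>g. f g \<otimes> (f g \<otimes> f g) = \<one>) \<and>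
     f RZ12 \<otimes> f Eta2 \<otimes> f Eta1 = f Eta1 \<otimes> f Eta2 \<and>
     f Eta2 \<otimes> f Eta3 \<otimes> f Eta1 = f Eta1 \<otimes> f Eta3 \<and>
     f RZ23 \<otimes> f Eta3 \<otimes> f Eta2 = f Eta2 \<otimes> f Eta3"
proof -
  have all: "(\<forall>g. P g) \<longleftrightarrow> P Eta1 \<and> P Eta2 \<and> P Eta3 \<and> P RZ12 \<and> P RZ23" for P
  proof (intro iffI allI)
    fix g assume "P Eta1 \<and> P Eta2 \<and> P Eta3 \<and> P RZ12 \<and> P RZ23"
    then show "P g" by (cases g) simp_all
  qed simp
  have inv_left: "f y \<otimes> f x = inv (f z) \<otimes> f x \<otimes> f y \<longleftrightarrow> f z \<otimes> f y \<otimes> f x = f x \<otimes> f y" for x y z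
    using inv_solve_left[of "f y \<otimes> f x" "f z" "f x \<otimes> f y"] by (auto simp: m_assoc)
  have conj: "word_val G f [Gen y, Gen x, Inv y] = word_val G f [Inv z, Gen x]
      \<longleftrightarrow> f z \<otimes> f y \<otimes> f x = f x \<otimes> f y" for x y z
    using conjugate_eq_iff[of "f y" "f x" "inv (f z) \<otimes> f x"] inv_left[of y x z] by simp
  have conj': "word_val G f [Gen Eta3, Gen Eta1, Inv Eta3] = word_val G f [Gen RZ12, Gen Eta1, Gen Eta2, Gen Eta2]
      \<longleftrightarrow> f Eta3 \<otimes> f Eta1 = f RZ12 \<otimes> (f Eta1 \<otimes> (f Eta2 \<otimes> f Eta2)) \<otimes> f Eta3"
    using conjugate_eq_iff[of "f Eta3" "f Eta1" "f RZ12 \<otimes> (f Eta1 \<otimes> (f Eta2 \<otimes> f Eta2))"] by simp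
  show ?thesis
    unfolding R_rels_def ball_Un central_rels_iff[OF f]
      all[of "\<lambda>g. f g \<otimes> (f g \<otimes> f g) = \<one>"]
    apply (simp only: ball_simps prod.case cube_rel_iff[OF f] conj conj' simp_thms)
    using conjugation_relation_iff[OF f f f f, of RZ12 Eta2 Eta1 Eta3] by blast
qed

end

lemma GT_group: "group GT"
  unfolding GT_def by (rule presented_group_is_group)

lemma RG_group: "group RG"
  unfolding RG_def by (rule presented_group_is_group)

lemma T_el_closed [simp]: "T_el g \<in> carrier GT"
  by (simp add: GT_def T_el_def presented_gen_closed)

lemma R_el_closed [simp]: "R_el g \<in> carrier RG"
  by (simp add: RG_def R_el_def presented_gen_closed)

lemma GT_relations:
  "\<And>g. T_el TZ12 \<otimes>\<^bsub>GT\<^esub> T_el g = T_el g \<otimes>\<^bsub>GT\<^esub> T_el TZ12"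
  "\<And>g. T_el g \<otimes>\<^bsub>GT\<^esub> (T_el g \<otimes>\<^bsub>GT\<^esub> T_el g) = \<one>\<^bsub>GT\<^esub>"
  "T_el TZ12 \<otimes>\<^bsub>GT\<^esub> T_el Xi2 \<otimes>\<^bsub>GT\<^esub> T_el Xi1 = T_el Xi1 \<otimes>\<^bsub>GT\<^esub> T_el Xi2"
  "T_el Xi2 \<otimes>\<^bsub>GT\<^esub> T_el Xi3 \<otimes>\<^bsub>GT\<^esub> T_el Xi1 = T_el Xi1 \<otimes>\<^bsub>GT\<^esub> T_el Xi3"
  "T_el Xi2 \<otimes>\<^bsub>GT\<^esub> T_el Xi3 = T_el Xi3 \<otimes>\<^bsub>GT\<^esub> T_el Xi2"
proof -
  have "\<forall>(u, v)\<in>T_rels. word_val GT T_el u = word_val GT T_el v"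
    unfolding GT_def T_el_def by (auto dest: presented_rel)
  note this[unfolded group.T_relations_iff[OF GT_group T_el_closed]]
  then show
    "\<And>g. T_el TZ12 \<otimes>\<^bsub>GT\<^esub> T_el g = T_el g \<otimes>\<^bsub>GT\<^esub> T_el TZ12"
    "\<And>g. T_el g \<otimes>\<^bsub>GT\<^esub> (T_el g \<otimes>\<^bsub>GT\<^esub> T_el g) = \<one>\<^bsub>GT\<^esub>"
    "T_el TZ12 \<otimes>\<^bsub>GT\<^esub> T_el Xi2 \<otimes>\<^bsub>GT\<^esub> T_el Xi1 = T_el Xi1 \<otimes>\<^bsub>GT\<^esub> T_el Xi2"
    "T_el Xi2 \<otimes>\<^bsub>GT\<^esub> T_el Xi3 \<otimes>\<^bsub>GT\<^esub> T_el Xi1 = T_el Xi1 \<otimes>\<^bsub>GT\<^esub> T_el Xi3"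
    "T_el Xi2 \<otimes>\<^bsub>GT\<^esub> T_el Xi3 = T_el Xi3 \<otimes>\<^bsub>GT\<^esub> T_el Xi2"
    by blast+
qed

lemma RG_relations:
  "\<And>g. R_el RZ12 \<otimes>\<^bsub>RG\<^esub> R_el g = R_el g \<otimes>\<^bsub>RG\<^esub> R_el RZ12"
  "\<And>g. R_el g \<otimes>\<^bsub>RG\<^esub> (R_el g \<otimes>\<^bsub>RG\<^esub> R_el g) = \<one>\<^bsub>RG\<^esub>"
  "R_el RZ12 \<otimes>\<^bsub>RG\<^esub> R_el Eta2 \<otimes>\<^bsub>RG\<^esub> R_el Eta1 = R_el Eta1 \<otimes>\<^bsub>RG\<^esub> R_el Eta2"
  "R_el Eta2 \<otimes>\<^bsub>RG\<^esub> R_el Eta3 \<otimes>\<^bsub>RG\<^esub> R_el Eta1 = R_el Eta1 \<otimes>\<^bsub>RG\<^esub> R_el Eta3"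
  "R_el RZ23 \<otimes>\<^bsub>RG\<^esub> R_el Eta3 \<otimes>\<^bsub>RG\<^esub> R_el Eta2 = R_el Eta2 \<otimes>\<^bsub>RG\<^esub> R_el Eta3"
proof -
  have "\<forall>(u, v)\<in>R_rels. word_val RG R_el u = word_val RG R_el v"
    unfolding RG_def R_el_def by (auto dest: presented_rel)
  note this[unfolded group.R_relations_iff[OF RG_group R_el_closed]]
  then show
    "\<And>g. R_el RZ12 \<otimes>\<^bsub>RG\<^esub> R_el g = R_el g \<otimes>\<^bsub>RG\<^esub> R_el RZ12"
    "\<And>g. R_el g \<otimes>\<^bsub>RG\<^esub> (R_el g \<otimes>\<^bsub>RG\<^esub> R_el g) = \<one>\<^bsub>RG\<^esub>"
    "R_el RZ12 \<otimes>\<^bsub>RG\<^esub> R_el Eta2 \<otimes>\<^bsub>RG\<^esub> R_el Eta1 = R_el Eta1 \<otimes>\<^bsub>RG\<^esub> R_el Eta2"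
    "R_el Eta2 \<otimes>\<^bsub>RG\<^esub> R_el Eta3 \<otimes>\<^bsub>RG\<^esub> R_el Eta1 = R_el Eta1 \<otimes>\<^bsub>RG\<^esub> R_el Eta3"
    "R_el RZ23 \<otimes>\<^bsub>RG\<^esub> R_el Eta3 \<otimes>\<^bsub>RG\<^esub> R_el Eta2 = R_el Eta2 \<otimes>\<^bsub>RG\<^esub> R_el Eta3"
    by blast+
qed

lemma delta_hom: "delta \<in> hom RG GT"
  and delta_gens: "delta (R_el Eta1) = T_el Xi1" "delta (R_el Eta2) = T_el Xi2"
    "delta (R_el Eta3) = T_el Xi3" "delta (R_el RZ12) = T_el TZ12" "delta (R_el RZ23) = \<one>\<^bsub>GT\<^esub>"
proof -
  interpret group GT by (rule GT_group)
  define f where "f = (\<lambda>g. case g of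
       Eta1 \<Rightarrow> T_el Xi1 | Eta2 \<Rightarrow> T_el Xi2 | Eta3 \<Rightarrow> T_el Xi3
     | RZ12 \<Rightarrow> T_el TZ12 | RZ23 \<Rightarrow> \<one>\<^bsub>GT\<^esub>)"
  have f: "f g \<in> carrier GT" for g by (cases g) (auto simp: f_def)
  have f_cases: "f g = \<one>\<^bsub>GT\<^esub> \<or> (\<exists>h. f g = T_el h)" for g
    by (cases g) (auto simp: f_def)
  have central: "T_el TZ12 \<otimes>\<^bsub>GT\<^esub> f g = f g \<otimes>\<^bsub>GT\<^esub> T_el TZ12" for g
    using f_cases[of g] by (elim disjE exE) (simp, simp only: GT_relations(1))
  have cube: "f g \<otimes>\<^bsub>GT\<^esub> (f g \<otimes>\<^bsub>GT\<^esub> f g) = \<one>\<^bsub>GT\<^esub>" for g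
    using f_cases[of g] by (elim disjE exE) (simp, simp only: GT_relations(2))
  have f_gens: "f Eta1 = T_el Xi1" "f Eta2 = T_el Xi2" "f Eta3 = T_el Xi3" "f RZ12 = T_el TZ12"
    "f RZ23 = \<one>\<^bsub>GT\<^esub>"
    by (simp_all add: f_def)
  have "\<forall>(u, v)\<in>R_rels. word_val GT f u = word_val GT f v"
    unfolding R_relations_iff[OF f]
    by (intro conjI allI)
      (simp_all add: f f_gens central cube GT_relations(3,4) GT_relations(5)[symmetric])
  then have rels: "word_val GT f u = word_val GT f v" if "(u, v) \<in> R_rels" for u v
    using that by blast
  have delta: "delta = induced_hom GT f" by (simp add: delta_def f_def)
  show "delta \<in> hom RG GT"
    unfolding delta RG_def by (rule induced_hom_is_hom[OF f rels])
  have "delta (R_el g) = f g" for g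
    unfolding delta R_el_def by (rule induced_hom_gen[OF f rels])
  then show "delta (R_el Eta1) = T_el Xi1" "delta (R_el Eta2) = T_el Xi2"
    "delta (R_el Eta3) = T_el Xi3" "delta (R_el RZ12) = T_el TZ12" "delta (R_el RZ23) = \<one>\<^bsub>GT\<^esub>"
    by (simp_all add: f_def)
qed

section \<open>The order 81 group as an extension of its subgroup \<open>U\<close>\<close>

lemma U_subgroup: "subgroup U GT"
  unfolding U_def by (rule group.generate_is_subgroup[OF GT_group]) auto

lemma U_gens: "T_el TZ12 \<in> U" "T_el Xi1 \<in> U" "T_el Xi2 \<in> U"
  unfolding U_def by (auto intro: generate.incl)

lemma U_closed: "u \<in> U \<Longrightarrow> u \<in> carrier GT"
  using subgroup.mem_carrier[OF U_subgroup] .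

text \<open>All three conjugates lie in \<open>U\<close>, which is therefore normalized by \<open>\<xi>\<^sub>3\<close>.\<close>

lemma Xi3_conj_gens:
  "T_el Xi3 \<otimes>\<^bsub>GT\<^esub> T_el TZ12 \<otimes>\<^bsub>GT\<^esub> inv\<^bsub>GT\<^esub> T_el Xi3 = T_el TZ12"
  "T_el Xi3 \<otimes>\<^bsub>GT\<^esub> T_el Xi1 \<otimes>\<^bsub>GT\<^esub> inv\<^bsub>GT\<^esub> T_el Xi3 = inv\<^bsub>GT\<^esub> T_el Xi2 \<otimes>\<^bsub>GT\<^esub> T_el Xi1"
  "T_el Xi3 \<otimes>\<^bsub>GT\<^esub> T_el Xi2 \<otimes>\<^bsub>GT\<^esub> inv\<^bsub>GT\<^esub> T_el Xi3 = T_el Xi2"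
proof -
  interpret group GT by (rule GT_group)
  show "T_el Xi3 \<otimes>\<^bsub>GT\<^esub> T_el TZ12 \<otimes>\<^bsub>GT\<^esub> inv\<^bsub>GT\<^esub> T_el Xi3 = T_el TZ12"
    using GT_relations(1)[of Xi3] by (simp add: inv_solve_right')
  show "T_el Xi3 \<otimes>\<^bsub>GT\<^esub> T_el Xi2 \<otimes>\<^bsub>GT\<^esub> inv\<^bsub>GT\<^esub> T_el Xi3 = T_el Xi2"
    using GT_relations(5) by (simp add: inv_solve_right')
  have "T_el Xi3 \<otimes>\<^bsub>GT\<^esub> T_el Xi1 = inv\<^bsub>GT\<^esub> T_el Xi2 \<otimes>\<^bsub>GT\<^esub> (T_el Xi1 \<otimes>\<^bsub>GT\<^esub> T_el Xi3)"
    using GT_relations(4) by (simp add: inv_solve_left m_assoc)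
  then show "T_el Xi3 \<otimes>\<^bsub>GT\<^esub> T_el Xi1 \<otimes>\<^bsub>GT\<^esub> inv\<^bsub>GT\<^esub> T_el Xi3 = inv\<^bsub>GT\<^esub> T_el Xi2 \<otimes>\<^bsub>GT\<^esub> T_el Xi1"
    by (simp add: inv_solve_right' m_assoc)
qed

lemma U_conj_Xi3:
  assumes "u \<in> U"
  shows "T_el Xi3 \<otimes>\<^bsub>GT\<^esub> u \<otimes>\<^bsub>GT\<^esub> inv\<^bsub>GT\<^esub> T_el Xi3 \<in> U"
proof -
  interpret group GT by (rule GT_group)
  interpret U: subgroup U GT by (rule U_subgroup)
  let ?c = "\<lambda>u. T_el Xi3 \<otimes>\<^bsub>GT\<^esub> u \<otimes>\<^bsub>GT\<^esub> inv\<^bsub>GT\<^esub> T_el Xi3"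
  have gen: "?c u \<in> U" if "u \<in> {T_el TZ12, T_el Xi1, T_el Xi2}" for u
    using that by (auto simp: Xi3_conj_gens U_gens)
  have c_inv: "?c (inv\<^bsub>GT\<^esub> u) = inv\<^bsub>GT\<^esub> (?c u)" if "u \<in> carrier GT" for u
    using that by (simp add: inv_mult_group m_assoc)
  have c_mult: "?c (u \<otimes>\<^bsub>GT\<^esub> v) = ?c u \<otimes>\<^bsub>GT\<^esub> ?c v" if "u \<in> carrier GT" "v \<in> carrier GT" for u v
    using that by (simp add: m_assoc) (simp add: m_assoc[symmetric])
  show ?thesis
    using assms unfolding U_def
  proof (induction rule: generate.induct)
    case one
    then show ?case using generate.one by simp
  next
    case (incl h)
    then show ?case using gen unfolding U_def by blast
  next
    case (inv h)
    moreover have "h \<in> carrier GT" using inv by auto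
    ultimately show ?case using gen[of h] c_inv[of h] U.m_inv_closed[of "?c h"] unfolding U_def by simp
  next
    case (eng h k)
    moreover have "h \<in> carrier GT" "k \<in> carrier GT"
      using eng U_closed unfolding U_def by blast+
    ultimately show ?case using c_mult[of h k] generate.eng by simp
  qed
qed

text \<open>Left multiplication by a generator preserves the set of products \<open>u w\<^sup>k\<close>: the generators of \<open>U\<close> act
  on \<open>u\<close> alone, and \<open>w u w\<^sup>k = (w u w\<^sup>-\<^sup>1) w\<^sup>k\<^sup>+\<^sup>1\<close> with \<open>w u w\<^sup>-\<^sup>1\<close> again in \<open>U\<close>.\<close>

lemma GT_decomposition:
  assumes "g \<in> carrier GT"
  shows "\<exists>u\<in>U. \<exists>k\<le>(2::nat). g = u \<otimes>\<^bsub>GT\<^esub> (T_el Xi3 [^]\<^bsub>GT\<^esub> k)"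
proof -
  interpret group GT by (rule GT_group)
  interpret U: subgroup U GT by (rule U_subgroup)
  let ?w = "T_el Xi3"
  define P where "P g \<longleftrightarrow> (\<exists>u\<in>U. \<exists>k\<le>(2::nat). g = u \<otimes>\<^bsub>GT\<^esub> (?w [^]\<^bsub>GT\<^esub> k))" for g
  have left_U: "P (v \<otimes>\<^bsub>GT\<^esub> x)" if v: "v \<in> U" and x: "P x" for v x
  proof -
    obtain u and k :: nat where "u \<in> U" "k \<le> 2" "x = u \<otimes>\<^bsub>GT\<^esub> (?w [^]\<^bsub>GT\<^esub> k)"
      using x unfolding P_def by blast
    moreover from this v have "v \<otimes>\<^bsub>GT\<^esub> x = (v \<otimes>\<^bsub>GT\<^esub> u) \<otimes>\<^bsub>GT\<^esub> (?w [^]\<^bsub>GT\<^esub> k)" "v \<otimes>\<^bsub>GT\<^esub> u \<in> U"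
      by (simp_all add: m_assoc U_closed)
    ultimately show ?thesis unfolding P_def by blast
  qed
  have w3: "?w [^]\<^bsub>GT\<^esub> (3::nat) = ?w [^]\<^bsub>GT\<^esub> (0::nat)"
    using GT_relations(2)[of Xi3] by (simp add: numeral_3_eq_3 m_assoc)
  have left_w: "P (?w \<otimes>\<^bsub>GT\<^esub> x)" if x: "P x" for x
  proof -
    obtain u and k :: nat where u: "u \<in> U" and k: "k \<le> 2" and x: "x = u \<otimes>\<^bsub>GT\<^esub> (?w [^]\<^bsub>GT\<^esub> k)"
      using x unfolding P_def by blast
    let ?c = "?w \<otimes>\<^bsub>GT\<^esub> u \<otimes>\<^bsub>GT\<^esub> inv\<^bsub>GT\<^esub> ?w"
    have cancel: "inv\<^bsub>GT\<^esub> ?w \<otimes>\<^bsub>GT\<^esub> (?w \<otimes>\<^bsub>GT\<^esub> y) = y" if "y \<in> carrier GT" for y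
      using that by (simp add: m_assoc[symmetric])
    have wx: "?w \<otimes>\<^bsub>GT\<^esub> x = ?c \<otimes>\<^bsub>GT\<^esub> (?w [^]\<^bsub>GT\<^esub> Suc k)"
      unfolding x nat_pow_Suc2[OF T_el_closed]
      using u U_closed[of u] cancel by (simp add: m_assoc)
    \<comment> \<open>The exponent wraps around, since \<open>w\<^sup>3 = 1\<close>.\<close>
    define k' where "k' = (if Suc k = 3 then 0 else Suc k)"
    have "k' \<le> 2" using k by (auto simp: k'_def)
    moreover have "?w [^]\<^bsub>GT\<^esub> Suc k = ?w [^]\<^bsub>GT\<^esub> k'"
      unfolding k'_def using w3 by (cases "Suc k = 3") (simp_all del: nat_pow_Suc)
    ultimately have "k' \<le> 2" "?w [^]\<^bsub>GT\<^esub> Suc k = ?w [^]\<^bsub>GT\<^esub> k'" .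
    then have "?w \<otimes>\<^bsub>GT\<^esub> x = ?c \<otimes>\<^bsub>GT\<^esub> (?w [^]\<^bsub>GT\<^esub> k')" "k' \<le> 2" using wx by simp_all
    then show ?thesis
      unfolding P_def by (intro bexI[OF _ U_conj_Xi3[OF u]] exI conjI)
  qed
  have inv_w: "inv\<^bsub>GT\<^esub> ?w = ?w \<otimes>\<^bsub>GT\<^esub> ?w"
    using GT_relations(2)[of Xi3] by (intro inv_equality) (simp_all add: m_assoc)
  have "P g"
    using assms unfolding GT_def
  proof (induction rule: presented_induct)
    case one
    have "\<one>\<^bsub>GT\<^esub> = \<one>\<^bsub>GT\<^esub> \<otimes>\<^bsub>GT\<^esub> (?w [^]\<^bsub>GT\<^esub> (0::nat))" by simp
    then show ?case
      unfolding GT_def[symmetric] P_def using U.one_closed zero_le[of "2::nat"] by blast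
  next
    case (gen g x)
    then show ?case unfolding GT_def[symmetric] T_el_def[symmetric]
      using left_U[OF U_gens(1)] left_U[OF U_gens(2)] left_U[OF U_gens(3)] left_w
      by (cases g) simp_all
  next
    case (inv g x)
    then have x: "x \<in> carrier GT" "P x" unfolding GT_def[symmetric] by simp_all
    have "P (inv\<^bsub>GT\<^esub> (T_el g) \<otimes>\<^bsub>GT\<^esub> x)"
    proof (cases g)
      case Xi3
      \<comment> \<open>The inverse of \<open>w\<close> is \<open>w\<^sup>2\<close>, so this case is two steps of left multiplication by \<open>w\<close>.\<close>
      have "inv\<^bsub>GT\<^esub> ?w \<otimes>\<^bsub>GT\<^esub> x = ?w \<otimes>\<^bsub>GT\<^esub> (?w \<otimes>\<^bsub>GT\<^esub> x)"
        unfolding inv_w using x(1) by (simp add: m_assoc)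
      then show ?thesis unfolding Xi3 using left_w[OF left_w[OF x(2)]] by simp
    qed (use left_U[OF U.m_inv_closed x(2)] U_gens in simp_all)
    then show ?case unfolding GT_def[symmetric] T_el_def[symmetric] .
  qed
  then show ?thesis unfolding P_def .
qed

section \<open>The clock and shift matrices\<close>

text \<open>For \<open>q = \<omega>\<^sup>\<epsilon>\<close> this is the diagonal matrix by which \<open>\<xi>\<^sub>1\<close> acts, as \<open>q\<^sup>2 = \<omega>\<^sup>-\<^sup>\<epsilon>\<close>. Together with the
  cyclic permutation matrix it generates the Heisenberg group modulo \<open>3\<close>.\<close>

definition clock :: "complex \<Rightarrow> complex mat" where
  "clock q = mat_of_rows_list 3 [[1, 0, 0], [0, q\<^sup>2, 0], [0, 0, q]]"

definition shift :: "complex mat" where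
  "shift = mat_of_rows_list 3 [[0, 1, 0], [0, 0, 1], [1, 0, 0]]"

lemma clock_carrier [simp]: "clock q \<in> carrier_mat 3 3"
  by (simp add: clock_def mat_of_rows_list_def numeral_3_eq_3)

lemma shift_carrier [simp]: "shift \<in> carrier_mat 3 3"
  by (simp add: shift_def mat_of_rows_list_def numeral_3_eq_3)

lemma clock_shift_dims [simp]:
  "dim_row (clock q) = 3" "dim_col (clock q) = 3" "dim_row shift = 3" "dim_col shift = 3"
  using clock_carrier shift_carrier by blast+

lemma less_3_cases: "(i::nat) < 3 \<longleftrightarrow> i = 0 \<or> i = 1 \<or> i = 2"
  by auto

lemma clock_mult_vec:
  assumes "v \<in> carrier_vec 3"
  shows "(clock q *\<^sub>v v) $ 0 = v $ 0" "(clock q *\<^sub>v v) $ 1 = q\<^sup>2 * v $ 1"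
    "(clock q *\<^sub>v v) $ 2 = q * v $ 2"
  using assms
  by (simp_all add: clock_def mat_of_rows_list_def scalar_prod_def numeral_3_eq_3 numeral_2_eq_2)

lemma shift_mult_vec:
  assumes "v \<in> carrier_vec 3"
  shows "(shift *\<^sub>v v) $ 0 = v $ 1" "(shift *\<^sub>v v) $ 1 = v $ 2" "(shift *\<^sub>v v) $ 2 = v $ 0"
  using assms
  by (simp_all add: shift_def mat_of_rows_list_def scalar_prod_def numeral_3_eq_3 numeral_2_eq_2)

lemma root_cube:
  fixes q :: complex
  assumes "1 + q + q\<^sup>2 = 0"
  shows "q ^ 3 = 1" "q \<noteq> 0" "q \<noteq> 1"
proof -
  have "q ^ 3 - 1 = (q - 1) * (1 + q + q\<^sup>2)"
    by (simp add: algebra_simps power2_eq_square power3_eq_cube)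
  then show "q ^ 3 = 1" using assms by simp
  show "q \<noteq> 0" using assms by auto
  show "q \<noteq> 1" using assms by auto
qed

text \<open>Averaging a vector of \<open>W\<close> over the powers of the clock matrix isolates its first coordinate,
  because \<open>1 + q + q\<^sup>2 = 0\<close>. After a cyclic shift this coordinate is nonzero, so \<open>W\<close> contains one
  standard basis vector and, shifting again, all of them.\<close>

lemma clock_shift_irreducible:
  fixes q :: complex
  assumes q: "1 + q + q\<^sup>2 = 0"
    and W: "VectorSpace.subspace class_ring W (module_vec TYPE(complex) 3)"
    and clock: "\<And>v. v \<in> W \<Longrightarrow> clock q *\<^sub>v v \<in> W"
    and shift: "\<And>v. v \<in> W \<Longrightarrow> shift *\<^sub>v v \<in> W"
  shows "W = {0\<^sub>v 3} \<or> W = carrier_vec 3"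
proof -
  have sub: "W \<subseteq> carrier_vec 3" and zero: "0\<^sub>v 3 \<in> W"
    and add: "\<And>v w. v \<in> W \<Longrightarrow> w \<in> W \<Longrightarrow> v + w \<in> W"
    and smult: "\<And>c v. v \<in> W \<Longrightarrow> c \<cdot>\<^sub>v v \<in> W"
    using W unfolding subspace_vec_iff by blast+
  have eqI: "v = w" if "v \<in> carrier_vec 3" "w \<in> carrier_vec 3"
    "v $ 0 = w $ 0" "v $ 1 = w $ 1" "v $ 2 = w $ 2" for v w :: "complex vec"
    using that by (intro eq_vecI) (auto simp: less_3_cases)
  have full: "W = carrier_vec 3" if v: "v \<in> W" and v0: "v $ 0 \<noteq> 0" for v
  proof -
    let ?e = "unit_vec 3 :: nat \<Rightarrow> complex vec"
    have v3: "v \<in> carrier_vec 3" using v sub by blast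
    have q4: "q\<^sup>2 * q\<^sup>2 = q"
      using root_cube(1)[OF q] by (simp add: power2_eq_square power3_eq_cube mult.assoc)
    have q4': "q\<^sup>2 * (q\<^sup>2 * x) = q * x" for x by (metis mult.assoc q4)
    have cv: "clock q *\<^sub>v v \<in> carrier_vec 3" using v3 by (intro mult_mat_vec_carrier) auto
    define u where "u = v + clock q *\<^sub>v v + clock q *\<^sub>v (clock q *\<^sub>v v)"
    have "u \<in> W" unfolding u_def using v by (intro add clock)
    moreover have "u \<in> carrier_vec 3" using \<open>u \<in> W\<close> sub by blast
    moreover have "u $ 0 = 3 * v $ 0" "u $ 1 = (1 + q + q\<^sup>2) * v $ 1" "u $ 2 = (1 + q + q\<^sup>2) * v $ 2"
      using clock_mult_vec[OF v3, of q] clock_mult_vec[OF cv, of q] q4'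
      by (simp_all add: u_def distrib_right) (simp add: power2_eq_square)
    ultimately have e0: "?e 0 \<in> W"
      using smult[of u "1 / (3 * v $ 0)"] v0 q
      by (subst eqI[of "?e 0" "(1 / (3 * v $ 0)) \<cdot>\<^sub>v u"]) auto
    have sh: "shift *\<^sub>v ?e 0 = ?e 2" "shift *\<^sub>v ?e 2 = ?e 1"
      using shift_mult_vec[of "?e 0"] shift_mult_vec[of "?e 2"]
      by (auto intro!: eqI mult_mat_vec_carrier[of _ 3 3])
    have e2: "?e 2 \<in> W" using shift[OF e0] sh by simp
    have e1: "?e 1 \<in> W" using shift[OF e2] sh by simp
    have "x \<in> W" if x: "x \<in> carrier_vec 3" for x
    proof -
      have "x = x $ 0 \<cdot>\<^sub>v ?e 0 + x $ 1 \<cdot>\<^sub>v ?e 1 + x $ 2 \<cdot>\<^sub>v ?e 2"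
        using x by (intro eqI) auto
      then show ?thesis using add smult e0 e1 e2 by metis
    qed
    then show ?thesis using sub by blast
  qed
  show ?thesis
  proof (cases "W = {0\<^sub>v 3}")
    case False
    then obtain v where v: "v \<in> W" "v \<noteq> 0\<^sub>v 3" using zero by blast
    have v3: "v \<in> carrier_vec 3" using v sub by blast
    have s3: "shift *\<^sub>v v \<in> carrier_vec 3" using v3 by (intro mult_mat_vec_carrier) auto
    have "v $ 0 \<noteq> 0 \<or> v $ 1 \<noteq> 0 \<or> v $ 2 \<noteq> 0"
      using v(2) eqI[OF v3 zero_carrier_vec] by auto
    then show ?thesis
      using full[OF v(1)] full[OF shift[OF v(1)]] full[OF shift[OF shift[OF v(1)]]]
        shift_mult_vec[OF v3] shift_mult_vec[OF s3] by auto
  qed simp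
qed

lemma mat3_eqI:
  assumes "A \<in> carrier_mat 3 3" "B \<in> carrier_mat 3 3"
    and "\<And>i j. i \<in> {0, 1, 2} \<Longrightarrow> j \<in> {0, 1, 2} \<Longrightarrow> A $$ (i, j) = B $$ (i, j)"
  shows "A = (B :: complex mat)"
  using assms by (intro eq_matI) (auto simp: less_3_cases)

lemma mat3_mult_index:
  assumes "A \<in> carrier_mat 3 3" "B \<in> carrier_mat 3 3" "i \<in> {0, 1, 2}" "j \<in> {0, 1, 2}"
  shows "(A * B) $$ (i, j) = A $$ (i, 0) * B $$ (0, j) + A $$ (i, 1) * B $$ (1, j)
    + A $$ (i, 2) * (B $$ (2, j) :: complex)"
proof -
  have "i < 3" "j < 3" using assms by auto
  then show ?thesis using assms(1,2)
    by (simp add: scalar_prod_def numeral_3_eq_3 numeral_2_eq_2)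
qed

lemma clock_index:
  "clock q $$ (0, 0) = 1" "clock q $$ (0, 1) = 0" "clock q $$ (0, 2) = 0"
  "clock q $$ (1, 0) = 0" "clock q $$ (1, 1) = q\<^sup>2" "clock q $$ (1, 2) = 0"
  "clock q $$ (2, 0) = 0" "clock q $$ (2, 1) = 0" "clock q $$ (2, 2) = q"
  by (simp_all add: clock_def mat_of_rows_list_def numeral_2_eq_2)

lemma shift_index:
  "shift $$ (0, 0) = 0" "shift $$ (0, 1) = 1" "shift $$ (0, 2) = 0"
  "shift $$ (1, 0) = 0" "shift $$ (1, 1) = 0" "shift $$ (1, 2) = 1"
  "shift $$ (2, 0) = 1" "shift $$ (2, 1) = 0" "shift $$ (2, 2) = 0"
  by (simp_all add: shift_def mat_of_rows_list_def numeral_2_eq_2)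

text \<open>The clock matrix has distinct eigenvalues, so \<open>T\<close> is diagonal; commuting with the cyclic shift
  makes its diagonal constant.\<close>

lemma clock_shift_commutant:
  assumes q: "1 + q + q\<^sup>2 = 0" and T: "T \<in> carrier_mat 3 3"
    and clock: "T * clock q = clock q * T" and shift: "T * shift = shift * T"
  shows "T = T $$ (0, 0) \<cdot>\<^sub>m 1\<^sub>m 3"
proof (rule mat3_eqI)
  have q': "q\<^sup>2 \<noteq> 1" "q\<^sup>2 \<noteq> q" "q \<noteq> 1"
    using root_cube[OF q] q by (auto simp: power2_eq_square power3_eq_cube)
  have c: "(T * clock q) $$ (i, j) = (clock q * T) $$ (i, j)" for i j by (simp add: clock)
  have s: "(T * shift) $$ (i, j) = (shift * T) $$ (i, j)" for i j by (simp add: shift)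
  have "T $$ (0, 1) = 0" "T $$ (0, 2) = 0" "T $$ (1, 0) = 0" "T $$ (1, 2) = 0"
    "T $$ (2, 0) = 0" "T $$ (2, 1) = 0"
    using c[of 0 1] c[of 0 2] c[of 1 0] c[of 1 2] c[of 2 0] c[of 2 1] q'
    by (simp_all add: mat3_mult_index[OF T clock_carrier] mat3_mult_index[OF clock_carrier T] clock_index
        del: index_mult_mat One_nat_def)
  moreover have "T $$ (1, 1) = T $$ (0, 0)" "T $$ (2, 2) = T $$ (1, 1)"
    using s[of 0 1] s[of 1 2]
    by (simp_all add: mat3_mult_index[OF T shift_carrier] mat3_mult_index[OF shift_carrier T] shift_index
        del: index_mult_mat One_nat_def)
  ultimately show "T $$ (i, j) = (T $$ (0, 0) \<cdot>\<^sub>m 1\<^sub>m 3) $$ (i, j)"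
    if "i \<in> {0, 1, 2}" "j \<in> {0, 1, 2}" for i j
    using that by auto
qed (use T in auto)

section \<open>Constructing an intertwiner\<close>

lemma cube_one_mult_vec:
  fixes A :: "'a::comm_ring_1 mat"
  assumes A: "A \<in> carrier_mat n n" and A3: "A * (A * A) = 1\<^sub>m n" and w: "w \<in> carrier_vec n"
  shows "A *\<^sub>v (A *\<^sub>v (A *\<^sub>v w)) = w"
proof -
  have "A *\<^sub>v (A *\<^sub>v (A *\<^sub>v w)) = A *\<^sub>v ((A * A) *\<^sub>v w)" using A w by simp
  also have "\<dots> = (A * (A * A)) *\<^sub>v w"
    using A w by (intro assoc_mult_mat_vec[symmetric]) auto
  finally show ?thesis using A3 w by simp
qed

lemma smult_mat_mult_vec:
  fixes M :: "'a::comm_ring_1 mat"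
  assumes "M \<in> carrier_mat n m" "w \<in> carrier_vec m"
  shows "(c \<cdot>\<^sub>m M) *\<^sub>v w = c \<cdot>\<^sub>v (M *\<^sub>v w)"
  using assms by (intro eq_vecI) auto

lemma quasi_commute_mult_vec:
  fixes A :: "'a::comm_ring_1 mat"
  assumes A: "A \<in> carrier_mat n n" and B: "B \<in> carrier_mat n n"
    and AB: "A * B = q \<cdot>\<^sub>m (B * A)" and w: "w \<in> carrier_vec n"
  shows "A *\<^sub>v (B *\<^sub>v w) = q \<cdot>\<^sub>v (B *\<^sub>v (A *\<^sub>v w))"
proof -
  have "A *\<^sub>v (B *\<^sub>v w) = (A * B) *\<^sub>v w" using A B w by simp
  also have "\<dots> = q \<cdot>\<^sub>v ((B * A) *\<^sub>v w)"
    unfolding AB using A B w by (intro smult_mat_mult_vec) auto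
  finally show ?thesis using A B w by simp
qed

text \<open>The operators \<open>P t = 1 + t A + t\<^sup>2 A\<^sup>2\<close> for \<open>t = 1, q, q\<^sup>2\<close> project, up to a factor, to the
  eigenspaces of \<open>A\<close> and add up to \<open>3\<close>, while \<open>P t B = B P (t q)\<close>: the matrix \<open>B\<close> permutes the three
  eigenspaces cyclically. Hence the eigenspace for eigenvalue \<open>1\<close> cannot vanish without all of them
  vanishing.\<close>

lemma heisenberg_fixed_vector:
  fixes A B :: "complex mat"
  assumes n: "n > 0" and A: "A \<in> carrier_mat n n" and B: "B \<in> carrier_mat n n"
    and A3: "A * (A * A) = 1\<^sub>m n" and B3: "B * (B * B) = 1\<^sub>m n"
    and AB: "A * B = q \<cdot>\<^sub>m (B * A)" and q: "1 + q + q\<^sup>2 = 0"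
  obtains v where "v \<in> carrier_vec n" "v \<noteq> 0\<^sub>v n" "A *\<^sub>v v = v"
proof -
  have Av: "A *\<^sub>v w \<in> carrier_vec n" and Bv: "B *\<^sub>v w \<in> carrier_vec n" if "w \<in> carrier_vec n" for w
    using that A B by auto
  have A3v: "A *\<^sub>v (A *\<^sub>v (A *\<^sub>v w)) = w" and B3v: "B *\<^sub>v (B *\<^sub>v (B *\<^sub>v w)) = w"
    if w: "w \<in> carrier_vec n" for w
    using cube_one_mult_vec[OF A A3 w] cube_one_mult_vec[OF B B3 w] .
  have ABv: "A *\<^sub>v (B *\<^sub>v w) = q \<cdot>\<^sub>v (B *\<^sub>v (A *\<^sub>v w))" if w: "w \<in> carrier_vec n" for w
    by (rule quasi_commute_mult_vec[OF A B AB w])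
  have lin_add: "A *\<^sub>v (x + y) = A *\<^sub>v x + A *\<^sub>v y" "B *\<^sub>v (x + y) = B *\<^sub>v x + B *\<^sub>v y"
    if "x \<in> carrier_vec n" "y \<in> carrier_vec n" for x y
    using that A B by (auto simp: mult_add_distrib_mat_vec)
  have lin_smult: "A *\<^sub>v (c \<cdot>\<^sub>v x) = c \<cdot>\<^sub>v (A *\<^sub>v x)" "B *\<^sub>v (c \<cdot>\<^sub>v x) = c \<cdot>\<^sub>v (B *\<^sub>v x)"
    if "x \<in> carrier_vec n" for x c
    using that A B by (auto simp: mult_mat_vec)
  note lin = lin_add lin_smult
  define P where "P t w = w + t \<cdot>\<^sub>v (A *\<^sub>v w) + t\<^sup>2 \<cdot>\<^sub>v (A *\<^sub>v (A *\<^sub>v w))" for t w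
  have Pv: "P t w \<in> carrier_vec n" if "w \<in> carrier_vec n" for t w
    using Av[OF that] Av[OF Av[OF that]] that by (simp add: P_def)
  have AP: "A *\<^sub>v P 1 w = P 1 w" if w: "w \<in> carrier_vec n" for w
  proof -
    have "A *\<^sub>v P 1 w = A *\<^sub>v w + A *\<^sub>v (A *\<^sub>v w) + w"
      using w Av[OF w] Av[OF Av[OF w]] by (simp add: P_def lin A3v)
    also have "\<dots> = w + (A *\<^sub>v w + A *\<^sub>v (A *\<^sub>v w))"
      using w Av[OF w] Av[OF Av[OF w]] by (intro comm_add_vec) auto
    also have "\<dots> = w + A *\<^sub>v w + A *\<^sub>v (A *\<^sub>v w)"
      using w Av[OF w] Av[OF Av[OF w]] by (intro assoc_add_vec[symmetric])
    finally show ?thesis by (simp add: P_def)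
  qed
  have PB: "P t (B *\<^sub>v w) = B *\<^sub>v P (t * q) w" if w: "w \<in> carrier_vec n" for t w
  proof -
    note c = w Av[OF w] Av[OF Av[OF w]]
    have r2: "A *\<^sub>v (A *\<^sub>v (B *\<^sub>v w)) = q\<^sup>2 \<cdot>\<^sub>v (B *\<^sub>v (A *\<^sub>v (A *\<^sub>v w)))"
      using c Bv[OF c(2)] by (simp add: ABv lin smult_smult_assoc power2_eq_square)
    have r3: "B *\<^sub>v P s w = B *\<^sub>v w + s \<cdot>\<^sub>v (B *\<^sub>v (A *\<^sub>v w)) + s\<^sup>2 \<cdot>\<^sub>v (B *\<^sub>v (A *\<^sub>v (A *\<^sub>v w)))" for s
      unfolding P_def
      by (subst lin_add(2), use c in simp, use c in simp)
        (subst lin_add(2), use c in \<open>simp_all add: lin_smult\<close>)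
    show ?thesis
      unfolding r3 unfolding P_def r2 unfolding ABv[OF w]
      by (simp add: smult_smult_assoc power_mult_distrib)
  qed
  have B_inj: "w = 0\<^sub>v n" if "w \<in> carrier_vec n" "B *\<^sub>v w = 0\<^sub>v n" for w
  proof -
    have "B *\<^sub>v 0\<^sub>v n = 0\<^sub>v n" using B by (intro eq_vecI) auto
    then show ?thesis using B3v[OF that(1)] by (simp add: that(2))
  qed
  define u :: "complex vec" where "u = unit_vec n 0"
  have u: "u \<in> carrier_vec n" "u $ 0 = 1" using n by (auto simp: u_def)
  have "P 1 u \<noteq> 0\<^sub>v n \<or> P 1 (B *\<^sub>v u) \<noteq> 0\<^sub>v n \<or> P 1 (B *\<^sub>v (B *\<^sub>v u)) \<noteq> 0\<^sub>v n"
  proof (rule ccontr)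
    assume "\<not> ?thesis"
    then have zero: "P 1 u = 0\<^sub>v n" "P 1 (B *\<^sub>v u) = 0\<^sub>v n" "P 1 (B *\<^sub>v (B *\<^sub>v u)) = 0\<^sub>v n" by auto
    have "P q u = 0\<^sub>v n"
      using zero(2) PB[OF u(1), of 1] B_inj[OF Pv[OF u(1)]] by simp
    have "P (q * q) u = 0\<^sub>v n"
    proof (rule B_inj[OF Pv[OF u(1)]], rule B_inj[OF Bv[OF Pv[OF u(1)]]])
      show "B *\<^sub>v (B *\<^sub>v P (q * q) u) = 0\<^sub>v n"
        using zero(3) PB[OF Bv[OF u(1)], of 1] PB[OF u(1), of q] by simp
    qed
    have "(u + t \<cdot>\<^sub>v x + s \<cdot>\<^sub>v y) $ 0 = u $ 0 + t * x $ 0 + s * y $ 0"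
      if "x \<in> carrier_vec n" "y \<in> carrier_vec n" for t s x y
      using that u(1) n by simp
    then have P0: "P t u $ 0 = u $ 0 + t * (A *\<^sub>v u) $ 0 + t\<^sup>2 * (A *\<^sub>v (A *\<^sub>v u)) $ 0" for t
      unfolding P_def using Av[OF u(1)] Av[OF Av[OF u(1)]] by blast
    define x where "x = (A *\<^sub>v u) $ 0"
    define y where "y = (A *\<^sub>v (A *\<^sub>v u)) $ 0"
    have "P 1 u $ 0 = 0" "P q u $ 0 = 0" "P (q * q) u $ 0 = 0"
      using zero(1) \<open>P q u = 0\<^sub>v n\<close> \<open>P (q * q) u = 0\<^sub>v n\<close> n by simp_all
    then have xy: "u $ 0 + x + y = 0" "u $ 0 + q * x + q\<^sup>2 * y = 0"
      "u $ 0 + (q * q) * x + (q * q)\<^sup>2 * y = 0"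
      unfolding P0 x_def y_def by simp_all
    \<comment> \<open>The last term uses \<open>1 + q\<^sup>2 + q\<^sup>4 = (1 + q + q\<^sup>2) (1 - q + q\<^sup>2)\<close>.\<close>
    have "3 * u $ 0 = (u $ 0 + x + y) + (u $ 0 + q * x + q\<^sup>2 * y)
        + (u $ 0 + (q * q) * x + (q * q)\<^sup>2 * y) - (1 + q + q\<^sup>2) * (x + (1 - q + q\<^sup>2) * y)"
      by (simp add: algebra_simps power2_eq_square)
    then have "3 * u $ 0 = 0" unfolding xy q by simp
    then show False using u(2) by simp
  qed
  then show ?thesis
    using that[OF Pv _ AP] u(1) Bv[OF u(1)] Bv[OF Bv[OF u(1)]] by blast
qed

text \<open>The matrix \<open>S\<close> sends the standard basis of three-space to \<open>v, B\<^sup>2 v, B v\<close>. The order of the last two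
  is dictated by the shift matrix, which maps the first basis vector to the third.\<close>

lemma heisenberg_intertwiner:
  fixes A B :: "complex mat"
  assumes A: "A \<in> carrier_mat n n" and B: "B \<in> carrier_mat n n"
    and B3: "B * (B * B) = 1\<^sub>m n"
    and AB: "A * B = q \<cdot>\<^sub>m (B * A)"
    and v: "v \<in> carrier_vec n" "v \<noteq> 0\<^sub>v n" "A *\<^sub>v v = v"
  obtains S where "S \<in> carrier_mat n 3" "S \<noteq> 0\<^sub>m n 3" "A * S = S * clock q" "B * S = S * shift"
proof -
  have Bv: "B *\<^sub>v w \<in> carrier_vec n" if "w \<in> carrier_vec n" for w
    using that B by auto
  have ABv: "A *\<^sub>v (B *\<^sub>v w) = q \<cdot>\<^sub>v (B *\<^sub>v (A *\<^sub>v w))" if w: "w \<in> carrier_vec n" for w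
    by (rule quasi_commute_mult_vec[OF A B AB w])
  have B3v: "B *\<^sub>v (B *\<^sub>v (B *\<^sub>v v)) = v"
    by (rule cube_one_mult_vec[OF B B3 v(1)])
  define S where "S = mat_of_cols n [v, B *\<^sub>v (B *\<^sub>v v), B *\<^sub>v v]"
  have S: "S \<in> carrier_mat n 3"
    using mat_of_cols_carrier(1)[of n "[v, B *\<^sub>v (B *\<^sub>v v), B *\<^sub>v v]"] by (simp add: S_def numeral_3_eq_3)
  have col: "col S 0 = v" "col S 1 = B *\<^sub>v (B *\<^sub>v v)" "col S 2 = B *\<^sub>v v"
    using v(1) Bv[OF v(1)] Bv[OF Bv[OF v(1)]] by (simp_all add: S_def)
  have S_unit: "S *\<^sub>v (c \<cdot>\<^sub>v unit_vec 3 j) = c \<cdot>\<^sub>v col S j" if "j < 3" for j c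
    using that S by (intro eq_vecI) auto
  have S_unit1: "S *\<^sub>v unit_vec 3 j = col S j" if "j < 3" for j
    using that S by (intro eq_vecI) auto
  have ccol: "col (clock q) 0 = 1 \<cdot>\<^sub>v unit_vec 3 0" "col (clock q) 1 = q\<^sup>2 \<cdot>\<^sub>v unit_vec 3 1"
    "col (clock q) 2 = q \<cdot>\<^sub>v unit_vec 3 2"
    by (intro eq_vecI; auto simp: less_3_cases clock_index simp del: One_nat_def)+
  have scol: "col shift 0 = 1 \<cdot>\<^sub>v unit_vec 3 2" "col shift 1 = 1 \<cdot>\<^sub>v unit_vec 3 0"
    "col shift 2 = 1 \<cdot>\<^sub>v unit_vec 3 1"
    by (intro eq_vecI; auto simp: less_3_cases shift_index simp del: One_nat_def)+
  have A_col: "A *\<^sub>v (B *\<^sub>v v) = q \<cdot>\<^sub>v (B *\<^sub>v v)" "A *\<^sub>v (B *\<^sub>v (B *\<^sub>v v)) = q\<^sup>2 \<cdot>\<^sub>v (B *\<^sub>v (B *\<^sub>v v))"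
    using v Bv[OF v(1)] Bv[OF Bv[OF v(1)]] B
    by (simp_all add: ABv mult_mat_vec[of B n n] smult_smult_assoc power2_eq_square)
  have "A * S = S * clock q"
  proof (rule mat_col_eqI)
    fix j assume "j < dim_col (S * clock q)"
    then have j: "j < 3" using carrier_matD[OF clock_carrier] by simp
    have "col (A * S) j = A *\<^sub>v col S j" using A S j by (intro col_mult2) auto
    also have "\<dots> = S *\<^sub>v col (clock q) j"
      using j unfolding less_3_cases
      by (elim disjE) (simp_all only: ccol col, simp_all only: A_col v(3), simp_all add: S_unit S_unit1 col del: One_nat_def)
    also have "\<dots> = col (S * clock q) j" using S j by (intro col_mult2[symmetric]) auto
    finally show "col (A * S) j = col (S * clock q) j" .
  qed (use A S carrier_matD[OF clock_carrier] in auto)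
  moreover have "B * S = S * shift"
  proof (rule mat_col_eqI)
    fix j assume "j < dim_col (S * shift)"
    then have j: "j < 3" using carrier_matD[OF shift_carrier] by simp
    have "col (B * S) j = B *\<^sub>v col S j" using B S j by (intro col_mult2) auto
    also have "\<dots> = S *\<^sub>v col shift j"
      using j unfolding less_3_cases
      by (elim disjE) (simp_all only: scol col, simp_all only: B3v, simp_all add: S_unit S_unit1 col del: One_nat_def)
    also have "\<dots> = col (S * shift) j" using S j by (intro col_mult2[symmetric]) auto
    finally show "col (B * S) j = col (S * shift) j" .
  qed (use B S carrier_matD[OF shift_carrier] in auto)
  moreover have "S \<noteq> 0\<^sub>m n 3"
    using col(1) v(2) by auto
  ultimately show ?thesis using that S by blast
qed

text \<open>The map \<open>S \<mapsto> C S J\<^sup>-\<^sup>1\<close> acts on the space of intertwiners for \<open>A\<close> and \<open>B\<close>, because \<open>C\<close> and \<open>J\<close> induce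
  the same automorphism on the groups generated by \<open>A, B\<close> and by \<open>a, b\<close>. Here \<open>J\<^sup>-\<^sup>1\<close> is written
  as \<open>J\<^sup>2\<close>.\<close>

lemma twisted_intertwiner:
  fixes A B C a b J S :: "'a::comm_ring_1 mat"
  assumes A: "A \<in> carrier_mat n n" and B: "B \<in> carrier_mat n n" and C: "C \<in> carrier_mat n n"
    and a: "a \<in> carrier_mat m m" and b: "b \<in> carrier_mat m m" and J: "J \<in> carrier_mat m m"
    and AC: "A * C = B * (C * A)" and BC: "B * C = C * B"
    and aJ: "a * J = b * (J * a)" and bJ: "b * J = J * b" and J3: "J * (J * J) = 1\<^sub>m m"
    and S: "S \<in> carrier_mat n m" and AS: "A * S = S * a" and BS: "B * S = S * b"
  shows "A * (C * (S * (J * J))) = C * (S * (J * J)) * a"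
    and "B * (C * (S * (J * J))) = C * (S * (J * J)) * b"
    and "C * (S * (J * J)) * J = C * S"
proof -
  note as = assoc_mult_mat
  note mc = mult_carrier_mat
  let ?J2 = "J * J"
  have J2: "?J2 \<in> carrier_mat m m" and SJ: "S * ?J2 \<in> carrier_mat n m"
    using J S by auto
  have J3': "?J2 * J = 1\<^sub>m m" using J3 as[OF J J J] by simp
  have bJ2: "b * ?J2 = ?J2 * b"
  proof -
    have "b * ?J2 = (b * J) * J" by (rule as[OF b J J, symmetric])
    also have "\<dots> = (J * b) * J" by (simp only: bJ)
    also have "\<dots> = J * (b * J)" by (rule as[OF J b J])
    also have "\<dots> = J * (J * b)" by (simp only: bJ)
    also have "\<dots> = (J * J) * b" by (rule as[OF J J b, symmetric])
    finally show ?thesis .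
  qed
  have aJ2: "?J2 * a = b * (a * ?J2)"
  proof -
    have "?J2 * a = ?J2 * (a * (J * ?J2))" unfolding J3 using a by simp
    also have "a * (J * ?J2) = (a * J) * ?J2" by (rule as[OF a J J2, symmetric])
    also have "\<dots> = b * (J * a * ?J2)" unfolding aJ by (rule as[OF b mc[OF J a] J2])
    also have "?J2 * \<dots> = (?J2 * b) * (J * a * ?J2)"
      by (rule as[OF J2 b mc[OF mc[OF J a] J2], symmetric])
    also have "\<dots> = b * (?J2 * (J * a * ?J2))"
      unfolding bJ2[symmetric] by (rule as[OF b J2 mc[OF mc[OF J a] J2]])
    also have "J * a * ?J2 = J * (a * ?J2)" by (rule as[OF J a J2])
    also have "?J2 * (J * (a * ?J2)) = (?J2 * J) * (a * ?J2)"
      by (rule as[OF J2 J mc[OF a J2], symmetric])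
    also have "\<dots> = a * ?J2" unfolding J3' by (rule left_mult_one_mat[OF mc[OF a J2]])
    finally show ?thesis .
  qed
  have "A * (C * (S * ?J2)) = (A * C) * (S * ?J2)" by (rule as[OF A C SJ, symmetric])
  also have "\<dots> = B * (C * A * (S * ?J2))" unfolding AC by (rule as[OF B mc[OF C A] SJ])
  also have "C * A * (S * ?J2) = C * (A * (S * ?J2))" by (rule as[OF C A SJ])
  also have "A * (S * ?J2) = (A * S) * ?J2" by (rule as[OF A S J2, symmetric])
  also have "\<dots> = S * (a * ?J2)" unfolding AS by (rule as[OF S a J2])
  also have "B * (C * (S * (a * ?J2))) = (B * C) * (S * (a * ?J2))"
    by (rule as[OF B C mc[OF S mc[OF a J2]], symmetric])
  also have "\<dots> = C * (B * (S * (a * ?J2)))"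
    unfolding BC by (rule as[OF C B mc[OF S mc[OF a J2]]])
  also have "B * (S * (a * ?J2)) = (B * S) * (a * ?J2)"
    by (rule as[OF B S mc[OF a J2], symmetric])
  also have "\<dots> = S * (?J2 * a)" unfolding BS aJ2 by (rule as[OF S b mc[OF a J2]])
  also have "\<dots> = S * ?J2 * a" by (rule as[OF S J2 a, symmetric])
  also have "C * \<dots> = C * (S * ?J2) * a" by (rule as[OF C SJ a, symmetric])
  finally show "A * (C * (S * ?J2)) = C * (S * ?J2) * a" .
  have "B * (C * (S * ?J2)) = (B * C) * (S * ?J2)" by (rule as[OF B C SJ, symmetric])
  also have "\<dots> = C * (B * (S * ?J2))" unfolding BC by (rule as[OF C B SJ])
  also have "B * (S * ?J2) = (B * S) * ?J2" by (rule as[OF B S J2, symmetric])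
  also have "\<dots> = S * (b * ?J2)" unfolding BS by (rule as[OF S b J2])
  also have "\<dots> = S * ?J2 * b" unfolding bJ2 by (rule as[OF S J2 b, symmetric])
  also have "C * \<dots> = C * (S * ?J2) * b" by (rule as[OF C SJ b, symmetric])
  finally show "B * (C * (S * ?J2)) = C * (S * ?J2) * b" .
  have "C * (S * ?J2) * J = C * (S * ?J2 * J)" by (rule as[OF C SJ J])
  also have "S * ?J2 * J = S * (?J2 * J)" by (rule as[OF S J2 J])
  also have "\<dots> = S" unfolding J3' using S by simp
  finally show "C * (S * ?J2) * J = C * S" .
qed

lemma cube_root_cyclic_sum:
  fixes t :: "'a::comm_ring_1"
  assumes "P \<in> carrier_mat n m" "Q \<in> carrier_mat n m" "R \<in> carrier_mat n m" and t: "t ^ 3 = 1"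
  shows "t \<cdot>\<^sub>m (P + (t\<^sup>2 \<cdot>\<^sub>m Q + t \<cdot>\<^sub>m R)) = Q + (t\<^sup>2 \<cdot>\<^sub>m R + t \<cdot>\<^sub>m P)"
proof -
  have "t * (x + (t\<^sup>2 * y + t * z)) = t ^ 3 * y + (t\<^sup>2 * z + t * x)" for x y z :: 'a
    by (simp add: algebra_simps power2_eq_square power3_eq_cube)
  then have "t * (x + (t\<^sup>2 * y + t * z)) = y + (t\<^sup>2 * z + t * x)" for x y z :: 'a
    using t by simp
  then show ?thesis using assms(1-3) by (intro eq_matI) simp_all
qed

text \<open>The map \<open>\<Phi> S = C S J\<^sup>-\<^sup>1\<close> satisfies \<open>\<Phi>\<^sup>3 = 1\<close>. An intertwiner for \<open>A\<close> and \<open>B\<close>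
  that also carries \<open>t J\<close> to \<open>C\<close>, for a cube root of unity \<open>t\<close>, is the same as an eigenvector of
  \<open>\<Phi>\<close> with eigenvalue \<open>t\<close>. The eigencomponents of \<open>S\<close>, one for each \<open>t\<close>, add up to \<open>S\<close>, so at
  least one of them is nonzero.\<close>

lemma extended_intertwiner:
  fixes A B C a b J S :: "complex mat"
  assumes A: "A \<in> carrier_mat n n" and B: "B \<in> carrier_mat n n" and C: "C \<in> carrier_mat n n"
    and a: "a \<in> carrier_mat m m" and b: "b \<in> carrier_mat m m" and J: "J \<in> carrier_mat m m"
    and AC: "A * C = B * (C * A)" and BC: "B * C = C * B" and C3: "C * (C * C) = 1\<^sub>m n"
    and aJ: "a * J = b * (J * a)" and bJ: "b * J = J * b" and J3: "J * (J * J) = 1\<^sub>m m"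
    and S: "S \<in> carrier_mat n m" and AS: "A * S = S * a" and BS: "B * S = S * b"
    and S_ne: "S \<noteq> 0\<^sub>m n m" and \<omega>: "1 + \<omega> + \<omega>\<^sup>2 = 0"
  shows "\<exists>r\<in>{0, 1, 2::nat}. \<exists>E\<in>carrier_mat n m. E \<noteq> 0\<^sub>m n m \<and> A * E = E * a \<and> B * E = E * b \<and>
    C * E = E * (\<omega> ^ r \<cdot>\<^sub>m J)"
proof -
  note tw = twisted_intertwiner[OF A B C a b J AC BC aJ bJ J3]
  define S1 where "S1 = C * (S * (J * J))"
  define S2 where "S2 = C * (S1 * (J * J))"
  have S1: "S1 \<in> carrier_mat n m" unfolding S1_def using C S J by auto
  have S2: "S2 \<in> carrier_mat n m" unfolding S2_def using C S1 J by auto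
  note f1 = tw[OF S AS BS, folded S1_def]
  note f2 = tw[OF S1 f1(1) f1(2), folded S2_def]
  have JJ: "J * J \<in> carrier_mat m m" using J by auto
  have "C * S2 = S * J"
  proof -
    have "C * (S2 * (J * J)) * J = C * S2" by (rule tw(3)[OF S2 f2(1,2)])
    moreover have "C * (S2 * (J * J)) = S"
    proof -
      have S1': "S1 = C * S * (J * J)"
        unfolding S1_def by (rule assoc_mult_mat[OF C S JJ, symmetric])
      have S2': "S2 = C * (C * S) * J"
      proof -
        have "S1 * (J * J) = C * S * ((J * J) * (J * J))"
          unfolding S1' by (rule assoc_mult_mat[OF mult_carrier_mat[OF C S] JJ JJ])
        also have "(J * J) * (J * J) = J * (J * (J * J))" by (rule assoc_mult_mat[OF J J JJ])
        also have "\<dots> = J" unfolding J3 by (rule right_mult_one_mat[OF J])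
        finally have "S1 * (J * J) = C * S * J" .
        then show ?thesis
          unfolding S2_def by (simp only: assoc_mult_mat[OF C mult_carrier_mat[OF C S] J])
      qed
      have "S2 * (J * J) = C * (C * S) * (J * (J * J))"
        unfolding S2' by (rule assoc_mult_mat[OF mult_carrier_mat[OF C mult_carrier_mat[OF C S]] J JJ])
      also have "\<dots> = C * (C * S)"
        unfolding J3 by (rule right_mult_one_mat[OF mult_carrier_mat[OF C mult_carrier_mat[OF C S]]])
      finally have "C * (S2 * (J * J)) = C * (C * (C * S))" by simp
      also have "C * (C * S) = (C * C) * S" by (rule assoc_mult_mat[OF C C S, symmetric])
      also have "C * \<dots> = C * (C * C) * S"
        by (rule assoc_mult_mat[OF C mult_carrier_mat[OF C C] S, symmetric])
      also have "\<dots> = S" unfolding C3 using S by simp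
      finally show ?thesis .
    qed
    ultimately show ?thesis by simp
  qed
  note C_shift = f1(3)[symmetric] f2(3)[symmetric] this
  \<comment> \<open>This is \<open>3\<close> times the component of \<open>S\<close> for the eigenvalue \<open>t\<close>, written using \<open>t\<^sup>-\<^sup>1 = t\<^sup>2\<close>.\<close>
  define E where "E t = S + (t\<^sup>2 \<cdot>\<^sub>m S1 + t \<cdot>\<^sub>m S2)" for t
  have E: "E t \<in> carrier_mat n m" for t unfolding E_def using S S1 S2 by auto
  have left: "M * E t = M * S + (t\<^sup>2 \<cdot>\<^sub>m (M * S1) + t \<cdot>\<^sub>m (M * S2))" if M: "M \<in> carrier_mat n n" for M t
    unfolding E_def using M S S1 S2
    by (simp add: mult_add_distrib_mat[of M n n _ m] mult_smult_distrib[of M n n _ m])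
  have right: "E t * N = S * N + (t\<^sup>2 \<cdot>\<^sub>m (S1 * N) + t \<cdot>\<^sub>m (S2 * N))" if N: "N \<in> carrier_mat m m" for N t
    unfolding E_def using N S S1 S2
    by (simp add: add_mult_distrib_mat[of _ n m _ N m] mult_smult_assoc_mat[of _ n m N m])
  have AE: "A * E t = E t * a" for t unfolding left[OF A] right[OF a] AS f1 f2 ..
  have BE: "B * E t = E t * b" for t unfolding left[OF B] right[OF b] BS f1 f2 ..
  have CE: "C * E t = E t * (t \<cdot>\<^sub>m J)" if t: "t ^ 3 = 1" for t
  proof -
    have SJ: "S * J \<in> carrier_mat n m" "S1 * J \<in> carrier_mat n m" "S2 * J \<in> carrier_mat n m"
      using S S1 S2 J by auto
    have "E t * (t \<cdot>\<^sub>m J) = t \<cdot>\<^sub>m (E t * J)" using E J by (rule mult_smult_distrib)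
    also have "\<dots> = t \<cdot>\<^sub>m (S * J + (t\<^sup>2 \<cdot>\<^sub>m (S1 * J) + t \<cdot>\<^sub>m (S2 * J)))" unfolding right[OF J] ..
    also have "\<dots> = S1 * J + (t\<^sup>2 \<cdot>\<^sub>m (S2 * J) + t \<cdot>\<^sub>m (S * J))"
      by (rule cube_root_cyclic_sum[OF SJ t])
    also have "\<dots> = C * E t" unfolding left[OF C] C_shift ..
    finally show ?thesis ..
  qed
  have "\<exists>r\<in>{0, 1, 2::nat}. E (\<omega> ^ r) \<noteq> 0\<^sub>m n m"
  proof (rule ccontr)
    assume "\<not> ?thesis"
    then have zero: "E 1 = 0\<^sub>m n m" "E \<omega> = 0\<^sub>m n m" "E (\<omega>\<^sup>2) = 0\<^sub>m n m" by auto
    have "S = 0\<^sub>m n m"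
    proof (rule eq_matI)
      fix i j assume "i < dim_row (0\<^sub>m n m :: complex mat)" "j < dim_col (0\<^sub>m n m :: complex mat)"
      then have ij: "i < n" "j < m" by auto
      define x y z where "x = S $$ (i, j)" "y = S1 $$ (i, j)" "z = S2 $$ (i, j)"
      have E_ij: "E t $$ (i, j) = x + (t\<^sup>2 * y + t * z)" for t
        unfolding E_def x_y_z_def using ij S S1 S2 by auto
      have "E 1 $$ (i, j) = 0" "E \<omega> $$ (i, j) = 0" "E (\<omega>\<^sup>2) $$ (i, j) = 0"
        using zero ij by simp_all
      note z0 = this[unfolded E_ij]
      have "3 * x = (x + (1\<^sup>2 * y + 1 * z)) + (x + (\<omega>\<^sup>2 * y + \<omega> * z))
          + (x + ((\<omega>\<^sup>2)\<^sup>2 * y + \<omega>\<^sup>2 * z)) - (1 + \<omega> + \<omega>\<^sup>2) * ((1 - \<omega> + \<omega>\<^sup>2) * y + z)"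
        by (simp add: algebra_simps power2_eq_square)
      then have "3 * x = 0" unfolding z0 \<omega> by simp
      then show "S $$ (i, j) = 0\<^sub>m n m $$ (i, j)" using ij by (simp add: x_y_z_def)
    qed (use S in auto)
    then show False using S_ne by simp
  qed
  then obtain r where r: "r \<in> {0, 1, 2::nat}" "E (\<omega> ^ r) \<noteq> 0\<^sub>m n m" by blast
  have "(\<omega> ^ r) ^ 3 = 1"
    using root_cube(1)[OF \<omega>] by (simp add: power_mult[symmetric] mult.commute[of r] power_mult)
  then show ?thesis using r E AE BE CE by blast
qed

section \<open>The representations of spin type\<close>

lemma omega_root: "1 + omega + omega\<^sup>2 = 0"
proof -
  have w: "omega = cis (2 * pi / 3)"
    by (simp add: omega_def cis_conv_exp mult.commute)
  show ?thesis
    unfolding w by (simp add: complex_eq_iff power2_eq_square cos_120 sin_120)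
qed

lemma omega_powi_root:
  assumes "\<epsilon> \<in> {1, - 1 :: int}"
  shows "1 + omega powi \<epsilon> + (omega powi \<epsilon>)\<^sup>2 = 0" "omega powi (- \<epsilon>) = (omega powi \<epsilon>)\<^sup>2"
proof -
  note w = root_cube[OF omega_root]
  have i: "inverse omega = omega\<^sup>2"
    by (rule inverse_unique) (use w in \<open>simp add: power2_eq_square power3_eq_cube mult.assoc\<close>)
  have "omega ^ 4 = omega ^ 3 * omega" by (simp add: eval_nat_numeral)
  then have w4: "omega ^ 4 = omega" using w by simp
  show "1 + omega powi \<epsilon> + (omega powi \<epsilon>)\<^sup>2 = 0" "omega powi (- \<epsilon>) = (omega powi \<epsilon>)\<^sup>2"
    using assms omega_root by (auto simp: i w4 ac_simps)
qed

lemma omega_power_inj: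
  assumes "r \<in> {0, 1, 2::nat}" "s \<in> {0, 1, 2}" "omega ^ r = omega ^ s"
  shows "r = s"
proof -
  note w = root_cube[OF omega_root]
  have "omega\<^sup>2 \<noteq> 1" "omega\<^sup>2 \<noteq> omega"
    using w by (auto simp: power2_eq_square power3_eq_cube)
  then show ?thesis using assms w by auto
qed

lemma smult_one_mult:
  fixes M :: "'a::comm_ring_1 mat"
  assumes "M \<in> carrier_mat n m"
  shows "(c \<cdot>\<^sub>m 1\<^sub>m n) * M = c \<cdot>\<^sub>m M" "M * (c \<cdot>\<^sub>m 1\<^sub>m m) = c \<cdot>\<^sub>m M"
  using assms mult_smult_assoc_mat[of "1\<^sub>m n" n n M m c] mult_smult_distrib[of M n m "1\<^sub>m m" m c]
  by auto

lemma smult_pow_mat: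
  fixes M :: "'a::comm_ring_1 mat"
  assumes M: "M \<in> carrier_mat n n"
  shows "(c \<cdot>\<^sub>m M) ^\<^sub>m k = c ^ k \<cdot>\<^sub>m M ^\<^sub>m k"
proof (induction k)
  case 0
  then show ?case using M by (intro eq_matI) auto
next
  case (Suc k)
  have P: "M ^\<^sub>m k \<in> carrier_mat n n" using M by simp
  have "(c \<cdot>\<^sub>m M) ^\<^sub>m Suc k = (c ^ k \<cdot>\<^sub>m M ^\<^sub>m k) * (c \<cdot>\<^sub>m M)" by (simp add: Suc)
  also have "\<dots> = c ^ k \<cdot>\<^sub>m (M ^\<^sub>m k * (c \<cdot>\<^sub>m M))"
    using M P by (intro mult_smult_assoc_mat) auto
  also have "M ^\<^sub>m k * (c \<cdot>\<^sub>m M) = c \<cdot>\<^sub>m (M ^\<^sub>m k * M)"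
    by (rule mult_smult_distrib[OF P M])
  also have "c ^ k \<cdot>\<^sub>m (c \<cdot>\<^sub>m (M ^\<^sub>m k * M)) = c ^ Suc k \<cdot>\<^sub>m M ^\<^sub>m Suc k"
    by (intro eq_matI) (auto simp: mult.assoc mult.left_commute)
  finally show ?case .
qed

lemma pow_mat_3: "M \<in> carrier_mat n n \<Longrightarrow> M ^\<^sub>m 3 = M * (M * M)"
  by (simp add: numeral_3_eq_3)

lemma smult_mult_smult:
  fixes M N :: "'a::comm_ring_1 mat"
  assumes "M \<in> carrier_mat n m" "N \<in> carrier_mat m l"
  shows "(c \<cdot>\<^sub>m M) * N = c \<cdot>\<^sub>m (M * N)" "M * (c \<cdot>\<^sub>m N) = c \<cdot>\<^sub>m (M * N)"
  using assms by (rule mult_smult_assoc_mat, rule mult_smult_distrib)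

lemma rep_cong:
  assumes "is_rep H n \<sigma>" "group H" "\<And>g. g \<in> carrier H \<Longrightarrow> \<pi> g = \<sigma> g"
  shows "is_rep H n \<pi>"
proof -
  have "g \<otimes>\<^bsub>H\<^esub> h \<in> carrier H" if "g \<in> carrier H" "h \<in> carrier H" for g h
    using assms(2) that by (simp add: group.is_monoid monoid.m_closed)
  then show ?thesis
    using assms(1,3) unfolding is_rep_def hom_def by auto
qed

text \<open>The sign \<open>\<epsilon>\<close> enters only through \<open>q = \<omega>\<^sup>\<epsilon>\<close>, a root of \<open>1 + q + q\<^sup>2\<close>, so that both signs are
  treated at once.\<close>

locale spin_data =
  fixes q :: complex and \<rho> :: "T_gen word set \<Rightarrow> complex mat" and J :: "complex mat"
  assumes q: "1 + q + q\<^sup>2 = 0"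
    and rho_rep: "is_rep (GT\<lparr>carrier := U\<rparr>) 3 \<rho>"
    and rho_gens: "\<rho> (T_el TZ12) = q \<cdot>\<^sub>m 1\<^sub>m 3" "\<rho> (T_el Xi1) = clock q" "\<rho> (T_el Xi2) = shift"
    and J_intertwines: "is_J \<rho> J"
begin

sublocale GT: group GT by (rule GT_group)
sublocale GL3: group "GL 3" by (rule GL_group)
sublocale U: subgroup U GT by (rule U_subgroup)

lemma U_group: "group (GT\<lparr>carrier := U\<rparr>)"
  by (rule GT.subgroup_imp_group[OF U_subgroup])

lemma rho_mult: "u \<in> U \<Longrightarrow> v \<in> U \<Longrightarrow> \<rho> (u \<otimes>\<^bsub>GT\<^esub> v) = \<rho> u * \<rho> v"
  using rep_mult[OF rho_rep] by simp

lemma rho_one: "\<rho> \<one>\<^bsub>GT\<^esub> = 1\<^sub>m 3"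
  using rep_one[OF rho_rep U_group] by simp

lemma rho_GL: "u \<in> U \<Longrightarrow> \<rho> u \<in> carrier (GL 3)"
  using rho_rep hom_in_carrier[of \<rho> "GT\<lparr>carrier := U\<rparr>" "GL 3" u] by (simp add: is_rep_def)

lemma rho_carrier: "u \<in> U \<Longrightarrow> \<rho> u \<in> carrier_mat 3 3"
  using rho_GL GL_carrier_mat by blast

lemma gens_GL: "q \<cdot>\<^sub>m 1\<^sub>m 3 \<in> carrier (GL 3)" "clock q \<in> carrier (GL 3)" "shift \<in> carrier (GL 3)"
  using rho_GL[OF U_gens(1)] rho_GL[OF U_gens(2)] rho_GL[OF U_gens(3)] by (simp_all add: rho_gens)

lemma J_carrier: "J \<in> carrier_mat 3 3"
  using J_intertwines by (simp add: is_J_def)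

lemma J_cube: "J * (J * J) = 1\<^sub>m 3"
  using J_intertwines pow_mat_3[OF J_carrier] by (simp add: is_J_def)

lemma gens_cube:
  "(q \<cdot>\<^sub>m 1\<^sub>m 3) * ((q \<cdot>\<^sub>m 1\<^sub>m 3) * (q \<cdot>\<^sub>m 1\<^sub>m 3)) = (1\<^sub>m 3 :: complex mat)"
  "clock q * (clock q * clock q) = 1\<^sub>m 3" "shift * (shift * shift) = 1\<^sub>m 3"
proof -
  have cube: "\<rho> u * (\<rho> u * \<rho> u) = 1\<^sub>m 3"
    if "u \<in> U" "u \<otimes>\<^bsub>GT\<^esub> (u \<otimes>\<^bsub>GT\<^esub> u) = \<one>\<^bsub>GT\<^esub>" for u
    using that rho_mult[of u u] rho_mult[of u "u \<otimes>\<^bsub>GT\<^esub> u"] rho_one by simp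
  show "(q \<cdot>\<^sub>m 1\<^sub>m 3) * ((q \<cdot>\<^sub>m 1\<^sub>m 3) * (q \<cdot>\<^sub>m 1\<^sub>m 3)) = (1\<^sub>m 3 :: complex mat)"
  "clock q * (clock q * clock q) = 1\<^sub>m 3" "shift * (shift * shift) = 1\<^sub>m 3"
    using cube[OF U_gens(1) GT_relations(2)] cube[OF U_gens(2) GT_relations(2)]
      cube[OF U_gens(3) GT_relations(2)] unfolding rho_gens by blast+
qed

lemma clock_shift_comm: "(q \<cdot>\<^sub>m 1\<^sub>m 3) * shift * clock q = clock q * shift"
proof -
  have "\<rho> (T_el TZ12 \<otimes>\<^bsub>GT\<^esub> T_el Xi2 \<otimes>\<^bsub>GT\<^esub> T_el Xi1) = \<rho> (T_el Xi1 \<otimes>\<^bsub>GT\<^esub> T_el Xi2)"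
    by (simp only: GT_relations(3))
  then show ?thesis
    by (simp only: rho_mult U_gens U.m_closed rho_gens)
qed

text \<open>The intertwining condition on \<open>J\<close>, read on the two noncentral generators of \<open>U\<close>, is exactly the
  pair of relations between \<open>\<xi>\<^sub>3\<close> and \<open>\<xi>\<^sub>1, \<xi>\<^sub>2\<close>.\<close>

lemma clock_J: "clock q * J = shift * (J * clock q)"
  and shift_J: "shift * J = J * shift"
proof -
  have J: "\<rho> (T_el Xi3 \<otimes>\<^bsub>GT\<^esub> u \<otimes>\<^bsub>GT\<^esub> inv\<^bsub>GT\<^esub> (T_el Xi3)) * J = J * \<rho> u" if "u \<in> U" for u
    using J_intertwines that by (simp add: is_J_def)
  show "shift * J = J * shift"
    using J[OF U_gens(3)] by (simp add: Xi3_conj_gens rho_gens)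
  let ?v = "inv\<^bsub>GT\<^esub> T_el Xi2 \<otimes>\<^bsub>GT\<^esub> T_el Xi1"
  have v: "?v \<in> U" using U_gens by (intro U.m_closed U.m_inv_closed)
  have "T_el Xi2 \<otimes>\<^bsub>GT\<^esub> ?v = T_el Xi1" by (simp add: GT.m_assoc[symmetric])
  then have "shift * \<rho> ?v = clock q"
    using rho_mult[OF U_gens(3) v] by (simp add: rho_gens)
  moreover have "\<rho> ?v * J = J * clock q"
    using J[OF U_gens(2)] by (simp add: Xi3_conj_gens rho_gens)
  ultimately show "clock q * J = shift * (J * clock q)"
    using assoc_mult_mat[OF shift_carrier rho_carrier[OF v] J_carrier] by simp
qed

text \<open>Prescribed on generators only, so that multiplicativity comes from the presentation and no
  computation with products \<open>u w\<^sup>k\<close> is required.\<close>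

definition sigma_gen :: "nat \<Rightarrow> T_gen \<Rightarrow> complex mat" where
  "sigma_gen r g = (case g of Xi1 \<Rightarrow> clock q | Xi2 \<Rightarrow> shift
     | Xi3 \<Rightarrow> omega ^ r \<cdot>\<^sub>m J | TZ12 \<Rightarrow> q \<cdot>\<^sub>m 1\<^sub>m 3)"

definition sigma :: "nat \<Rightarrow> T_gen word set \<Rightarrow> complex mat" where
  "sigma r = induced_hom (GL 3) (sigma_gen r)"

lemma twisted_J_cube: "(omega ^ r \<cdot>\<^sub>m J) * ((omega ^ r \<cdot>\<^sub>m J) * (omega ^ r \<cdot>\<^sub>m J)) = 1\<^sub>m 3"
proof -
  have "(omega ^ r) ^ 3 = (omega ^ 3) ^ r" by (simp add: power_mult[symmetric] mult.commute)
  then have c: "(omega ^ r) ^ 3 = 1" using root_cube(1)[OF omega_root] by simp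
  have "(omega ^ r \<cdot>\<^sub>m J) ^\<^sub>m 3 = 1\<^sub>m 3"
    using J_intertwines unfolding smult_pow_mat[OF J_carrier] c by (auto simp: is_J_def)
  then show ?thesis
    using pow_mat_3[of "omega ^ r \<cdot>\<^sub>m J" 3] J_carrier by simp
qed

lemma sigma_gen_GL: "sigma_gen r g \<in> carrier (GL 3)"
proof (cases g)
  case Xi3
  let ?K = "omega ^ r \<cdot>\<^sub>m J"
  have K: "?K \<in> carrier_mat 3 3" using J_carrier by simp
  have "(?K * ?K) * ?K = 1\<^sub>m 3"
    unfolding assoc_mult_mat[OF K K K] by (rule twisted_J_cube)
  then have "?K \<in> carrier (GL 3)"
    unfolding GL_carrier_iff using K mult_carrier_mat[OF K K] twisted_J_cube[of r] by blast
  then show ?thesis by (simp add: Xi3 sigma_gen_def)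
qed (simp_all add: sigma_gen_def gens_GL)

lemma sigma_gen_relations:
  assumes "(u, v) \<in> T_rels"
  shows "word_val (GL 3) (sigma_gen r) u = word_val (GL 3) (sigma_gen r) v"
proof -
  let ?c = "omega ^ r"
  have cases: "sigma_gen r Xi1 = clock q" "sigma_gen r Xi2 = shift" "sigma_gen r Xi3 = ?c \<cdot>\<^sub>m J"
    "sigma_gen r TZ12 = q \<cdot>\<^sub>m 1\<^sub>m 3"
    by (simp_all add: sigma_gen_def)
  have car: "sigma_gen r g \<in> carrier_mat 3 3" for g
    using sigma_gen_GL by (rule GL_carrier_mat)
  have central: "(q \<cdot>\<^sub>m 1\<^sub>m 3) * sigma_gen r g = sigma_gen r g * (q \<cdot>\<^sub>m 1\<^sub>m 3)" for g
    by (simp only: smult_one_mult[OF car])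
  have cube: "sigma_gen r g * (sigma_gen r g * sigma_gen r g) = 1\<^sub>m 3" for g
    by (cases g) (simp_all only: cases gens_cube twisted_J_cube)
  have bJ: "shift * (?c \<cdot>\<^sub>m J) = ?c \<cdot>\<^sub>m (shift * J)" and Jb: "(?c \<cdot>\<^sub>m J) * shift = ?c \<cdot>\<^sub>m (J * shift)"
    and aJ: "clock q * (?c \<cdot>\<^sub>m J) = ?c \<cdot>\<^sub>m (clock q * J)"
    by (rule smult_mult_smult(2)[OF shift_carrier J_carrier] smult_mult_smult(1)[OF J_carrier shift_carrier]
        smult_mult_smult(2)[OF clock_carrier J_carrier])+
  have "shift * (?c \<cdot>\<^sub>m J) * clock q = ?c \<cdot>\<^sub>m (shift * J * clock q)"
    unfolding bJ by (rule smult_mult_smult(1)[OF mult_carrier_mat[OF shift_carrier J_carrier] clock_carrier])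
  also have "\<dots> = clock q * (?c \<cdot>\<^sub>m J)"
    unfolding aJ clock_J assoc_mult_mat[OF shift_carrier J_carrier clock_carrier] ..
  finally have conj: "shift * (?c \<cdot>\<^sub>m J) * clock q = clock q * (?c \<cdot>\<^sub>m J)" .
  have "\<forall>(u, v)\<in>T_rels. word_val (GL 3) (sigma_gen r) u = word_val (GL 3) (sigma_gen r) v"
    unfolding GL3.T_relations_iff[OF sigma_gen_GL] GL_simps
    using central cube clock_shift_comm conj bJ Jb shift_J
    by (simp only: cases simp_thms)
  then show ?thesis using assms by blast
qed

lemma sigma_rep: "is_rep GT 3 (sigma r)"
  unfolding is_rep_def sigma_def GT_def
  by (rule GL3.induced_hom_is_hom[OF sigma_gen_GL sigma_gen_relations])

lemma sigma_gens: "sigma r (T_el g) = sigma_gen r g"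
  unfolding sigma_def T_el_def
  by (rule GL3.induced_hom_gen[OF sigma_gen_GL sigma_gen_relations])

lemma sigma_hom: "group_hom GT (GL 3) (sigma r)"
  using sigma_rep[of r] GT.group_axioms GL3.group_axioms
  by (simp add: group_hom_def group_hom_axioms_def is_rep_def)

lemma rho_hom: "group_hom (GT\<lparr>carrier := U\<rparr>) (GL 3) \<rho>"
  using rho_rep U_group GL3.group_axioms
  by (simp add: group_hom_def group_hom_axioms_def is_rep_def)

lemma sigma_extends_rho:
  assumes "u \<in> U"
  shows "sigma r u = \<rho> u"
proof -
  interpret S: group_hom GT "GL 3" "sigma r" by (rule sigma_hom)
  interpret R: group_hom "GT\<lparr>carrier := U\<rparr>" "GL 3" \<rho> by (rule rho_hom)
  have gen: "sigma r u = \<rho> u" if "u \<in> {T_el TZ12, T_el Xi1, T_el Xi2}" for u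
    using that by (auto simp: sigma_gens sigma_gen_def rho_gens)
  show ?thesis
    using assms unfolding U_def
  proof (induction rule: generate.induct)
    case one
    then show ?case using S.hom_one rho_one by simp
  next
    case (incl h)
    then show ?case by (rule gen)
  next
    case (inv h)
    then have h: "h \<in> U" using U_gens by auto
    have "\<rho> (inv\<^bsub>GT\<^esub> h) = inv\<^bsub>GL 3\<^esub> (\<rho> h)"
      using R.hom_inv[of h] h GT.m_inv_consistent[OF U_subgroup h] by simp
    then show ?case using S.hom_inv[of h] U_closed[OF h] gen[OF inv] by simp
  next
    case (eng h k)
    then have "h \<in> U" "k \<in> U" by (simp_all add: U_def)
    then show ?case using S.hom_mult[of h k] eng.IH by (simp add: U_closed rho_mult)
  qed
qed

text \<open>Any decomposition \<open>g = u w\<^sup>k\<close> gives the value of the homomorphism \<open>sigma r\<close> at \<open>g\<close>. This yields the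
  uniqueness required by the definite description without comparing decompositions.\<close>

lemma Pi_rep_eq_sigma:
  assumes g: "g \<in> carrier GT"
  shows "Pi_rep \<rho> J r g = sigma r g"
proof -
  interpret S: group_hom GT "GL 3" "sigma r" by (rule sigma_hom)
  let ?c = "omega ^ r"
  have val: "sigma r (u \<otimes>\<^bsub>GT\<^esub> (T_el Xi3 [^]\<^bsub>GT\<^esub> k)) = omega ^ (r * k) \<cdot>\<^sub>m (\<rho> u * J ^\<^sub>m k)"
    if u: "u \<in> U" for u and k :: nat
  proof -
    have "sigma r (T_el Xi3 [^]\<^bsub>GT\<^esub> k) = sigma r (T_el Xi3) [^]\<^bsub>GL 3\<^esub> k"
      by (rule S.hom_nat_pow) simp
    also have "\<dots> = (?c \<cdot>\<^sub>m J) ^\<^sub>m k"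
      using GL_pow[OF sigma_gen_GL[of r Xi3]] by (simp add: sigma_gens sigma_gen_def)
    also have "\<dots> = ?c ^ k \<cdot>\<^sub>m J ^\<^sub>m k" by (rule smult_pow_mat[OF J_carrier])
    finally have "sigma r (T_el Xi3 [^]\<^bsub>GT\<^esub> k) = omega ^ (r * k) \<cdot>\<^sub>m J ^\<^sub>m k"
      by (simp add: power_mult)
    then have "sigma r (u \<otimes>\<^bsub>GT\<^esub> (T_el Xi3 [^]\<^bsub>GT\<^esub> k)) = \<rho> u * (omega ^ (r * k) \<cdot>\<^sub>m J ^\<^sub>m k)"
      using S.hom_mult[of u "T_el Xi3 [^]\<^bsub>GT\<^esub> k"] u by (simp add: U_closed sigma_extends_rho)
    also have "\<dots> = omega ^ (r * k) \<cdot>\<^sub>m (\<rho> u * J ^\<^sub>m k)"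
      using rho_carrier[OF u] J_carrier by (intro mult_smult_distrib) auto
    finally show ?thesis .
  qed
  show ?thesis unfolding Pi_rep_def
  proof (rule the_equality)
    show "\<exists>u\<in>U. \<exists>k\<le>2. g = u \<otimes>\<^bsub>GT\<^esub> T_el Xi3 [^]\<^bsub>GT\<^esub> k \<and> sigma r g = omega ^ (r * k) \<cdot>\<^sub>m (\<rho> u * J ^\<^sub>m k)"
      using GT_decomposition[OF g] val by metis
    show "M = sigma r g"
      if "\<exists>u\<in>U. \<exists>k\<le>2. g = u \<otimes>\<^bsub>GT\<^esub> T_el Xi3 [^]\<^bsub>GT\<^esub> k \<and> M = omega ^ (r * k) \<cdot>\<^sub>m (\<rho> u * J ^\<^sub>m k)" for M
      using that val by metis
  qed
qed

abbreviation Pi_R :: "nat \<Rightarrow> R_gen word set \<Rightarrow> complex mat" where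
  "Pi_R r \<equiv> Pi_rep \<rho> J r \<circ> delta"

lemma delta_closed: "g \<in> carrier RG \<Longrightarrow> delta g \<in> carrier GT"
  using delta_hom hom_in_carrier by fastforce

lemma Pi_gens:
  "Pi_R r (R_el Eta1) = clock q" "Pi_R r (R_el Eta2) = shift" "Pi_R r (R_el Eta3) = omega ^ r \<cdot>\<^sub>m J"
  "Pi_R r (R_el RZ12) = q \<cdot>\<^sub>m 1\<^sub>m 3" "Pi_R r (R_el RZ23) = 1\<^sub>m 3"
proof -
  interpret S: group_hom GT "GL 3" "sigma r" by (rule sigma_hom)
  show "Pi_R r (R_el Eta1) = clock q" "Pi_R r (R_el Eta2) = shift" "Pi_R r (R_el Eta3) = omega ^ r \<cdot>\<^sub>m J"
    "Pi_R r (R_el RZ12) = q \<cdot>\<^sub>m 1\<^sub>m 3" "Pi_R r (R_el RZ23) = 1\<^sub>m 3"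
    using S.hom_one by (simp_all add: delta_gens Pi_rep_eq_sigma sigma_gens sigma_gen_def)
qed

lemma Pi_is_rep: "is_rep RG 3 (Pi_R r)"
proof (rule rep_cong[OF _ RG_group])
  show "is_rep RG 3 (sigma r \<circ> delta)"
    using sigma_rep[of r] delta_hom unfolding is_rep_def by (rule hom_compose[rotated])
qed (simp add: Pi_rep_eq_sigma delta_closed)

lemma Pi_irrep: "is_irrep RG 3 (Pi_R r)"
  unfolding is_irrep_def
proof (intro conjI allI impI)
  fix W
  assume W: "VectorSpace.subspace class_ring W (module_vec TYPE(complex) 3) \<and>
    (\<forall>g\<in>carrier RG. \<forall>v\<in>W. Pi_R r g *\<^sub>v v \<in> W)"
  have "clock q *\<^sub>v v \<in> W" "shift *\<^sub>v v \<in> W" if "v \<in> W" for v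
    using W that Pi_gens(1,2)[of r] R_el_closed[of Eta1] R_el_closed[of Eta2] by metis+
  then show "W = {0\<^sub>v 3} \<or> W = carrier_vec 3"
    using W by (intro clock_shift_irreducible[OF q]) auto
qed (simp_all add: Pi_is_rep)

text \<open>An equivalence commutes with the clock and the shift, hence is a scalar. It then identifies the
  actions of \<open>\<eta>\<^sub>3\<close>, which are \<open>\<omega>\<^sup>r J\<close> and \<open>\<omega>\<^sup>s J\<close>.\<close>

lemma Pi_inequivalent:
  assumes r: "r \<in> {0, 1, 2}" and s: "s \<in> {0, 1, 2}" and equiv: "rep_equiv RG 3 (Pi_R r) 3 (Pi_R s)"
  shows "r = s"
proof -
  obtain T where T: "T \<in> carrier (GL 3)" and inter: "\<And>g. g \<in> carrier RG \<Longrightarrow> T * Pi_R r g = Pi_R s g * T"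
    using equiv unfolding rep_equiv_def by blast
  have T3: "T \<in> carrier_mat 3 3" using T by (rule GL_carrier_mat)
  define c where "c = T $$ (0, 0)"
  have "T = c \<cdot>\<^sub>m 1\<^sub>m 3"
    using clock_shift_commutant[OF q T3] inter[OF R_el_closed[of Eta1]] inter[OF R_el_closed[of Eta2]]
    unfolding Pi_gens c_def by blast
  note Tc = this
  have "c \<noteq> 0"
  proof
    assume "c = 0"
    obtain B where B: "B \<in> carrier_mat 3 3" "T * B = 1\<^sub>m 3" using T unfolding GL_carrier_iff by blast
    have "T * B = c \<cdot>\<^sub>m B" unfolding Tc by (rule smult_one_mult(1)[OF B(1)])
    then have "(1\<^sub>m 3 :: complex mat) = 0 \<cdot>\<^sub>m B" using B(2) \<open>c = 0\<close> by simp
    then have "(1\<^sub>m 3 :: complex mat) $$ (0, 0) = (0 \<cdot>\<^sub>m B) $$ (0, 0)" by simp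
    then show False using B(1) by simp
  qed
  have J': "omega ^ k \<cdot>\<^sub>m J \<in> carrier_mat 3 3" for k using J_carrier by simp
  have "c \<cdot>\<^sub>m (omega ^ r \<cdot>\<^sub>m J) = c \<cdot>\<^sub>m (omega ^ s \<cdot>\<^sub>m J)"
    using inter[OF R_el_closed[of Eta3]] unfolding Pi_gens Tc
    by (simp only: smult_one_mult[OF J'])
  then have "(c \<cdot>\<^sub>m (omega ^ r \<cdot>\<^sub>m J)) * (J * J) = (c \<cdot>\<^sub>m (omega ^ s \<cdot>\<^sub>m J)) * (J * J)" by simp
  moreover have "(c \<cdot>\<^sub>m (omega ^ k \<cdot>\<^sub>m J)) * (J * J) = c \<cdot>\<^sub>m (omega ^ k \<cdot>\<^sub>m 1\<^sub>m 3)" for k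
    by (simp only: smult_mult_smult(1)[OF J' mult_carrier_mat[OF J_carrier J_carrier]]
        smult_mult_smult(1)[OF J_carrier mult_carrier_mat[OF J_carrier J_carrier]] J_cube)
  ultimately have "(c \<cdot>\<^sub>m (omega ^ r \<cdot>\<^sub>m 1\<^sub>m 3)) $$ (0, 0) = (c \<cdot>\<^sub>m (omega ^ s \<cdot>\<^sub>m 1\<^sub>m 3)) $$ (0, 0)"
    by simp
  then have "omega ^ r = omega ^ s" using \<open>c \<noteq> 0\<close> by simp
  then show ?thesis by (rule omega_power_inj[OF r s])
qed

text \<open>A vector fixed by \<open>\<eta>\<^sub>1\<close> spans, under \<open>\<eta>\<^sub>2\<close>, a copy of the clock and shift representation. Projecting the
  inclusion of this copy to an eigencomponent makes it compatible with \<open>\<eta>\<^sub>3\<close>, and Schur's lemma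
  applies.\<close>

lemma Pi_complete:
  assumes irrep: "is_irrep RG n \<pi>"
    and z12: "\<pi> (R_el RZ12) = q \<cdot>\<^sub>m 1\<^sub>m n" and z23: "\<pi> (R_el RZ23) = 1\<^sub>m n"
  shows "\<exists>r\<in>{0, 1, 2}. rep_equiv RG n \<pi> 3 (Pi_R r)"
proof -
  interpret RG: group RG by (rule RG_group)
  have rep: "is_rep RG n \<pi>" and n: "n > 0" using irrep by (simp_all add: is_irrep_def)
  define A where "A = \<pi> (R_el Eta1)"
  define B where "B = \<pi> (R_el Eta2)"
  define C where "C = \<pi> (R_el Eta3)"
  have car: "A \<in> carrier_mat n n" "B \<in> carrier_mat n n" "C \<in> carrier_mat n n"
    unfolding A_def B_def C_def by (simp_all add: rep_carrier_mat[OF rep])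
  have m: "\<pi> (x \<otimes>\<^bsub>RG\<^esub> y) = \<pi> x * \<pi> y" if "x \<in> carrier RG" "y \<in> carrier RG" for x y
    using rep_mult[OF rep] that .
  have cube: "\<pi> (R_el g) * (\<pi> (R_el g) * \<pi> (R_el g)) = 1\<^sub>m n" for g
    using arg_cong[OF RG_relations(2)[of g], of \<pi>] rep_one[OF rep RG_group] by (simp add: m)
  have "(q \<cdot>\<^sub>m 1\<^sub>m n) * B * A = A * B"
    using arg_cong[OF RG_relations(3), of \<pi>] by (simp add: m z12 A_def B_def)
  moreover have "(q \<cdot>\<^sub>m 1\<^sub>m n) * B * A = q \<cdot>\<^sub>m (B * A)"
    unfolding smult_one_mult(1)[OF car(2)] by (rule smult_mult_smult(1)[OF car(2,1)])
  ultimately have AB: "A * B = q \<cdot>\<^sub>m (B * A)" by simp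
  have "B * C * A = A * C"
    using arg_cong[OF RG_relations(4), of \<pi>] by (simp add: m A_def B_def C_def)
  then have AC: "A * C = B * (C * A)" using assoc_mult_mat[OF car(2,3,1)] by simp
  have BC: "B * C = C * B"
    using arg_cong[OF RG_relations(5), of \<pi>] car by (simp add: m z23 B_def C_def)
  obtain v where v: "v \<in> carrier_vec n" "v \<noteq> 0\<^sub>v n" "A *\<^sub>v v = v"
    using heisenberg_fixed_vector[OF n car(1,2) _ _ AB q] cube unfolding A_def B_def by blast
  obtain S where S: "S \<in> carrier_mat n 3" "S \<noteq> 0\<^sub>m n 3" "A * S = S * clock q" "B * S = S * shift"
    using heisenberg_intertwiner[OF car(1,2) _ AB v] cube unfolding B_def by blast
  have C3: "C * (C * C) = 1\<^sub>m n" unfolding C_def by (rule cube)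
  obtain r E where r: "r \<in> {0, 1, 2::nat}" and E: "E \<in> carrier_mat n 3" "E \<noteq> 0\<^sub>m n 3"
    "A * E = E * clock q" "B * E = E * shift" "C * E = E * (omega ^ r \<cdot>\<^sub>m J)"
    using extended_intertwiner[OF car clock_carrier shift_carrier J_carrier AC BC C3 clock_J shift_J
        J_cube S(1,3,4,2) omega_root] by blast
  have "\<pi> (R_el g) * E = E * Pi_R r (R_el g)" for g
    using E(3-5) by (cases g)
      (simp_all only: Pi_gens z12 z23 A_def B_def C_def smult_one_mult[OF E(1)]
        left_mult_one_mat[OF E(1)] right_mult_one_mat[OF E(1)])
  then have "\<pi> g * E = E * Pi_R r g" if "g \<in> carrier RG" for g
    using intertwines_presented[of R_rels n \<pi> 3 "Pi_R r" E g] rep Pi_is_rep[of r] E(1) that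
    unfolding RG_def R_el_def by blast
  then have "rep_equiv RG n \<pi> 3 (Pi_R r)"
    by (rule nonzero_intertwiner_imp_rep_equiv[OF irrep Pi_irrep E(1,2)])
  then show ?thesis using r by blast
qed

end

theorem theorem6p8:
  fixes \<epsilon> :: int
    and \<rho> :: "T_gen word set \<Rightarrow> complex mat"
    and J :: "complex mat"
  assumes "\<epsilon> \<in> {1, - 1}"
    and "is_P \<epsilon> \<rho>"
    and "is_J \<rho> J"
  shows "(\<forall>r\<in>{0, 1, 2}. is_spin_irrep \<epsilon> 0 3 (Pi_rep \<rho> J r \<circ> delta)) \<and>
    (\<forall>r\<in>{0, 1, 2}. \<forall>s\<in>{0, 1, 2}. r \<noteq> s \<longrightarrow>
       \<not> rep_equiv RG 3 (Pi_rep \<rho> J r \<circ> delta) 3 (Pi_rep \<rho> J s \<circ> delta)) \<and>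
    (\<forall>n \<pi>. is_spin_irrep \<epsilon> 0 n \<pi> \<longrightarrow>
       (\<exists>r\<in>{0, 1, 2}. rep_equiv RG n \<pi> 3 (Pi_rep \<rho> J r \<circ> delta)))"
proof -
  define q where "q = omega powi \<epsilon>"
  interpret spin_data q \<rho> J
    using assms omega_powi_root[OF assms(1)]
    by unfold_locales (auto simp: is_P_def q_def clock_def shift_def)
  have one: "(1 \<cdot>\<^sub>m 1\<^sub>m n :: complex mat) = 1\<^sub>m n" for n
    by (intro eq_matI) auto
  have spin: "is_spin_irrep \<epsilon> 0 n \<pi> \<longleftrightarrow>
    is_irrep RG n \<pi> \<and> \<pi> (R_el RZ12) = q \<cdot>\<^sub>m 1\<^sub>m n \<and> \<pi> (R_el RZ23) = 1\<^sub>m n" for n \<pi>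
    unfolding is_spin_irrep_def q_def power_int_0_right one ..
  show ?thesis
    unfolding spin
  proof (intro conjI ballI allI impI)
    fix r s :: nat
    assume rs: "r \<in> {0, 1, 2}" "s \<in> {0, 1, 2}" and ne: "r \<noteq> s"
    show "\<not> rep_equiv RG 3 (Pi_R r) 3 (Pi_R s)"
    proof
      assume "rep_equiv RG 3 (Pi_R r) 3 (Pi_R s)"
      with ne show False using Pi_inequivalent[OF rs] by simp
    qed
  next
    fix n \<pi>
    assume "is_irrep RG n \<pi> \<and> \<pi> (R_el RZ12) = q \<cdot>\<^sub>m 1\<^sub>m n \<and> \<pi> (R_el RZ23) = 1\<^sub>m n"
    then show "\<exists>r\<in>{0, 1, 2}. rep_equiv RG n \<pi> 3 (Pi_R r)" by (intro Pi_complete) simp_all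
  qed (rule Pi_irrep Pi_gens)+
qed

end
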